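(* Let $I_X,I_Y$ be two rank indicator functions of order $m\ge4$ and dimensions $r$ and $s$, respectively, let $H_{\tau^*}=\langle(1\ 4),(2\ 3)\rangle\le S_m$, and let $\mu=\mu_{I_X,I_Y,H_{\tau^*}}$ be the corresponding Symmetric Rank Covariance. Suppose that $X$ and $Y$ are independent. If the invariance group of $\mu$ contains the subgroup $\langle(1\ 2),(3\ 4)\rangle$, then $\kappa_1(z^1)\equiv0$, so that $U_\mu$ is a degenerate U-statistic (i.e. $\sqrt n\,(U_\mu(Z^{[n]})-EU_\mu(Z^{[n]}))\to0$ in probability), and $$\kappa_2(z^1,z^2)=\frac{4}{\binom m2}\,E\bigl[a_{I_X}(x^1,x^2,X^3,\dots,X^m)\bigr]\,E\bigl[a_{I_Y}(y^1,y^2,Y^3,\dots,Y^m)\bigr],$$ where for any rank indicator function $I$ of order $m\ge4$, $a_I(w^{[m]})=\sum_{\sigma\in H_{\tau^*}}\mathrm{sign}(\sigma)I(w^{\sigma[m]})$. Moreover, the condition that the invariance group contains $\langle(1\ 2),(3\ 4)\rangle$ is satisfied for the pairs of rank indicator functions representing $\tau^*$, $D$ and $R$, and for all $\tau^*$ extensions.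
   Context: For $\sigma\in S_m$ and $w^{[m]}=(w^1,\dots,w^m)\in\mathbb{R}^{d\times m}$, $w^{\sigma[m]}=\sigma w^{[m]}=(w^{\sigma^{-1}(1)},\dots,w^{\sigma^{-1}(m)})$. Joint rank matrix: $\mathcal{R}(w^{[m]})_{ij}=1+\sum_{k=1}^m1_{[w^k_i<w^j_i]}$. A rank indicator function of order $m$ and dimension $d$ is $I:\mathbb{R}^{d\times m}\to\{0,1\}$ with $I(\mathcal{R}(w^{[m]}))=I(w^{[m]})$ for all $w^{[m]}$. The invariance group of $I$ is the group of all $\sigma\in S_m$ with $I(\sigma w^{[m]})=I(w^{[m]})$ for all $w^{[m]}$; the invariance group of $\mu_{I_X,I_Y,H}$ is $G_X\cap G_Y$, where $G_X,G_Y$ are the invariance groups of $I_X,I_Y$. $Z^i=(X^i,Y^i)$, $i\ge1$, are i.i.d. copies of $(X,Y)\in\mathbb{R}^r\times\mathbb{R}^s$; $z^i=(x^i,y^i)$. With $$k(z^{[m]})=\Big(\sum_{\sigma\in H}\mathrm{sign}(\sigma)I_X(x^{\sigma[m]})\Big)\Big(\sum_{\sigma\in H}\mathrm{sign}(\sigma)I_Y(y^{\sigma[m]})\Big),\qquad\kappa(z^{[m]})=\frac1{m!}\sum_{\sigma\in S_m}k(z^{\sigma[m]}),$$ one sets $\mu_{I_X,I_Y,H}(X,Y)=E[k(Z^{[m]})]$, $\kappa_i(z^1,\dots,z^i)=E[\kappa(z^1,\dots,z^i,Z^{i+1},\dots,Z^m)]$, and $U_\mu(z^{[n]})=\binom nm^{-1}\sum_{1\le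 i_1<\dots<i_m\le n}\kappa(z^{i_1},\dots,z^{i_m})$. Representing indicators ($a\preceq b$ means coordinatewise $\le$; a relation between lists means it holds for every pair of left and right elements). $\tau^*$ ($r=s=1$, $m=4$): $I_X=I_Y=I_{\tau^*}$, $I_{\tau^*}(w^{[4]})=1_{[\max(w^1,w^2)<\min(w^3,w^4)]}$. $D$ ($m=5$): $I_X,I_Y$ both given by $1_{[w^1,w^2\preceq w^5]}1_{[w^3,w^4\not\preceq w^5]}$ in dimensions $r$ and $s$. $R$ ($m=4+r+s$): $I_X(w)=1_{[w^1,w^2\preceq u]}1_{[w^3,w^4\not\preceq u]}$ with $u=(w^5_1,\dots,w^{4+r}_r)$ and $I_Y(w)=1_{[w^1,w^2\preceq v]}1_{[w^3,w^4\not\preceq v]}$ with $v=(w^{4+r+1}_1,\dots,w^{4+r+s}_s)$. A $\tau^*$ extension is a Symmetric Rank Covariance $\mu_{I_X,I_Y,H_{\tau^*}}$ where $I_X,I_Y$ are rank indicator functions of order $4$ with invariance group $\langle(1\ 2),(3\ 4)\rangle$. *)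

theory Defs
  imports "HOL-Probability.Probability" "HOL-Algebra.Sym_Groups"
begin

text \<open>
  A matrix \<open>w\<^sup>[\<^sup>m\<^sup>] = (w\<^sup>1, \<dots>, w\<^sup>m)\<close> in \<open>\<real>\<^sup>d\<^sup>\<times>\<^sup>m\<close> is a function \<open>nat \<Rightarrow> real ^ 'd\<close> of which only the
  columns \<open>1, \<dots>, m\<close> matter.  The symmetric group is the library's \<^const>\<open>sym_group\<close>, whose
  elements are the functions permuting \<open>{1..m}\<close>.
\<close>

definition perm_act :: "(nat \<Rightarrow> nat) \<Rightarrow> (nat \<Rightarrow> 'b) \<Rightarrow> nat \<Rightarrow> 'b" where
  "perm_act \<sigma> w = (\<lambda>j. w (Hilbert_Choice.inv \<sigma> j))"

text \<open>
  The columns outside \<open>{1..m}\<close> of a joint rank matrix are set to 0.  The equation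
  \<open>I (joint_rank m w) = I w\<close> therefore also forces \<open>I\<close> to ignore these columns, so that rank
  indicators here correspond exactly to those on \<open>\<real>\<^sup>d\<^sup>\<times>\<^sup>m\<close>.
\<close>

definition joint_rank :: "nat \<Rightarrow> (nat \<Rightarrow> real ^ 'd) \<Rightarrow> nat \<Rightarrow> real ^ 'd" where
  "joint_rank m w =
     (\<lambda>j. \<chi> i. if j \<in> {1..m} then 1 + (\<Sum>k = 1..m. of_bool (w k $ i < w j $ i)) else 0)"

definition rank_indicator :: "nat \<Rightarrow> ((nat \<Rightarrow> real ^ 'd) \<Rightarrow> real) \<Rightarrow> bool" where
  "rank_indicator m I \<longleftrightarrow> (\<forall>w. I w \<in> {0, 1} \<and> I (joint_rank m w) = I w)"

definition invariance_group :: "nat \<Rightarrow> ((nat \<Rightarrow> real ^ 'd) \<Rightarrow> real) \<Rightarrow> (nat \<Rightarrow> nat) set" where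
  "invariance_group m I = {\<sigma> \<in> carrier (sym_group m). \<forall>w. I (perm_act \<sigma> w) = I w}"

text \<open>
  The invariance group, the kernels and the U-statistic below belong to the representation
  \<open>(I\<^sub>X, I\<^sub>Y, H)\<close> of a symmetric rank covariance, not to its value.
\<close>

definition src_invariance_group ::
  "nat \<Rightarrow> ((nat \<Rightarrow> real ^ 'r) \<Rightarrow> real) \<Rightarrow> ((nat \<Rightarrow> real ^ 's) \<Rightarrow> real) \<Rightarrow> (nat \<Rightarrow> nat) set" where
  "src_invariance_group m IX IY = invariance_group m IX \<inter> invariance_group m IY"

definition H_tau_star :: "nat \<Rightarrow> (nat \<Rightarrow> nat) set" where
  "H_tau_star m = generate (sym_group m) {Transposition.transpose 1 4, Transposition.transpose 2 3}"

definition G_tau_star :: "nat \<Rightarrow> (nat \<Rightarrow> nat) set" where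
  "G_tau_star m = generate (sym_group m) {Transposition.transpose 1 2, Transposition.transpose 3 4}"

text \<open>For \<open>H = H_tau_star m\<close> this is the function \<open>a\<^sub>I\<close>.\<close>

definition signed_sum :: "(nat \<Rightarrow> nat) set \<Rightarrow> ((nat \<Rightarrow> 'b) \<Rightarrow> real) \<Rightarrow> (nat \<Rightarrow> 'b) \<Rightarrow> real" where
  "signed_sum H I w = (\<Sum>\<sigma>\<in>H. real_of_int (sign \<sigma>) * I (perm_act \<sigma> w))"

definition src_k ::
  "(nat \<Rightarrow> nat) set \<Rightarrow> ((nat \<Rightarrow> real ^ 'r) \<Rightarrow> real) \<Rightarrow> ((nat \<Rightarrow> real ^ 's) \<Rightarrow> real) \<Rightarrow>
   (nat \<Rightarrow> (real ^ 'r) \<times> (real ^ 's)) \<Rightarrow> real" where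
  "src_k H IX IY z = signed_sum H IX (\<lambda>j. fst (z j)) * signed_sum H IY (\<lambda>j. snd (z j))"

definition src_kappa ::
  "nat \<Rightarrow> (nat \<Rightarrow> nat) set \<Rightarrow> ((nat \<Rightarrow> real ^ 'r) \<Rightarrow> real) \<Rightarrow> ((nat \<Rightarrow> real ^ 's) \<Rightarrow> real) \<Rightarrow>
   (nat \<Rightarrow> (real ^ 'r) \<times> (real ^ 's)) \<Rightarrow> real" where
  "src_kappa m H IX IY z =
     1 / fact m * (\<Sum>\<sigma>\<in>carrier (sym_group m). src_k H IX IY (perm_act \<sigma> z))"

text \<open>
  In the next definitions \<open>Z 1, Z 2, \<dots>\<close> are the i.i.d. copies of \<open>(X, Y)\<close>, defined on the
  probability space \<open>M\<close>.
\<close>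

definition src_mu ::
  "'a measure \<Rightarrow> (nat \<Rightarrow> 'a \<Rightarrow> (real ^ 'r) \<times> (real ^ 's)) \<Rightarrow> (nat \<Rightarrow> nat) set \<Rightarrow>
   ((nat \<Rightarrow> real ^ 'r) \<Rightarrow> real) \<Rightarrow> ((nat \<Rightarrow> real ^ 's) \<Rightarrow> real) \<Rightarrow> real" where
  "src_mu M Z H IX IY = (\<integral>\<omega>. src_k H IX IY (\<lambda>j. Z j \<omega>) \<partial>M)"

text \<open>\<open>splice_at i z z' = (z\<^sup>1, \<dots>, z\<^sup>i, z'\<^sup>i\<^sup>+\<^sup>1, z'\<^sup>i\<^sup>+\<^sup>2, \<dots>)\<close>\<close>

definition splice_at :: "nat \<Rightarrow> (nat \<Rightarrow> 'b) \<Rightarrow> (nat \<Rightarrow> 'b) \<Rightarrow> nat \<Rightarrow> 'b" where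
  "splice_at i z z' = (\<lambda>j. if j \<le> i then z j else z' j)"

definition src_kappa_proj ::
  "'a measure \<Rightarrow> (nat \<Rightarrow> 'a \<Rightarrow> (real ^ 'r) \<times> (real ^ 's)) \<Rightarrow> nat \<Rightarrow> (nat \<Rightarrow> nat) set \<Rightarrow>
   ((nat \<Rightarrow> real ^ 'r) \<Rightarrow> real) \<Rightarrow> ((nat \<Rightarrow> real ^ 's) \<Rightarrow> real) \<Rightarrow>
   nat \<Rightarrow> (nat \<Rightarrow> (real ^ 'r) \<times> (real ^ 's)) \<Rightarrow> real" where
  "src_kappa_proj M Z m H IX IY i z =
     (\<integral>\<omega>. src_kappa m H IX IY (splice_at i z (\<lambda>j. Z j \<omega>)) \<partial>M)"

definition src_U ::
  "nat \<Rightarrow> (nat \<Rightarrow> nat) set \<Rightarrow> ((nat \<Rightarrow> real ^ 'r) \<Rightarrow> real) \<Rightarrow> ((nat \<Rightarrow> real ^ 's) \<Rightarrow> real) \<Rightarrow>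
   nat \<Rightarrow> (nat \<Rightarrow> (real ^ 'r) \<times> (real ^ 's)) \<Rightarrow> real" where
  "src_U m H IX IY n z =
     1 / real (n choose m) *
     (\<Sum>i\<in>{i \<in> {1..m} \<rightarrow>\<^sub>E {1..n}. strict_mono_on {1..m} i}. src_kappa m H IX IY (\<lambda>j. z (i j)))"

text \<open>The library's \<open>indep_var\<close> requires both random variables to have the same type.\<close>

definition independent_rvs ::
  "'a measure \<Rightarrow> ('a \<Rightarrow> 'b::topological_space) \<Rightarrow> ('a \<Rightarrow> 'c::topological_space) \<Rightarrow> bool" where
  "independent_rvs M X Y \<longleftrightarrow>
     X \<in> borel_measurable M \<and> Y \<in> borel_measurable M \<and>
     prob_space.indep_set M {X -` A \<inter> space M |A. A \<in> sets borel}
                            {Y -` B \<inter> space M |B. B \<in> sets borel}"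

definition converges_in_prob ::
  "'a measure \<Rightarrow> (nat \<Rightarrow> 'a \<Rightarrow> real) \<Rightarrow> ('a \<Rightarrow> real) \<Rightarrow> bool" where
  "converges_in_prob M T L \<longleftrightarrow>
     (\<forall>\<epsilon>>0. (\<lambda>n. measure M {\<omega> \<in> space M. \<bar>T n \<omega> - L \<omega>\<bar> > \<epsilon>}) \<longlonglongrightarrow> 0)"

definition I_tau_star :: "(nat \<Rightarrow> real ^ 1) \<Rightarrow> real" where
  "I_tau_star w = of_bool (max (w 1 $ 1) (w 2 $ 1) < min (w 3 $ 1) (w 4 $ 1))"

text \<open>The order on \<open>real ^ 'd\<close> is the coordinatewise one.\<close>

definition I_D :: "(nat \<Rightarrow> real ^ 'd) \<Rightarrow> real" where
  "I_D w = of_bool (w 1 \<le> w 5 \<and> w 2 \<le> w 5) * of_bool (\<not> w 3 \<le> w 5 \<and> \<not> w 4 \<le> w 5)"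

text \<open>
  \<open>p i\<close> is the column from which the \<open>i\<close>-th coordinate of the comparison point is taken.
  With \<open>num\<close> a numbering of the coordinates by \<open>1, \<dots>, d\<close>, the choice \<open>p i = 4 + num i\<close> gives
  \<open>(w\<^sup>5\<^sub>1, \<dots>, w\<^sup>4\<^sup>+\<^sup>d\<^sub>d)\<close>.
\<close>

definition I_R :: "('d \<Rightarrow> nat) \<Rightarrow> (nat \<Rightarrow> real ^ 'd) \<Rightarrow> real" where
  "I_R p w = (let u = (\<chi> i. w (p i) $ i) in
     of_bool (w 1 \<le> u \<and> w 2 \<le> u) * of_bool (\<not> w 3 \<le> u \<and> \<not> w 4 \<le> u))"

definition tau_star_extension ::
  "((nat \<Rightarrow> real ^ 'r) \<Rightarrow> real) \<Rightarrow> ((nat \<Rightarrow> real ^ 's) \<Rightarrow> real) \<Rightarrow> bool" where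
  "tau_star_extension IX IY \<longleftrightarrow>
     rank_indicator 4 IX \<and> rank_indicator 4 IY \<and>
     invariance_group 4 IX = G_tau_star 4 \<and> invariance_group 4 IY = G_tau_star 4"

end

theory Submission
  imports Defs
begin

text \<open>
  The signed sum \<open>a\<^sub>I\<close> changes sign when the arguments 1 and 4, or the arguments 2 and 3, are
  interchanged.  Independence of \<open>X\<close> and \<open>Y\<close> allows one to interchange two random
  \<open>X\<close>-observations while leaving the \<open>Y\<close>-observations alone, which changes the sign of \<open>k\<close> but
  not the joint law.  So an expectation involving \<open>k\<close> vanishes as soon as one of the pairs
  \<open>{1, 4}\<close>, \<open>{2, 3}\<close> consists of free random arguments.  With one fixed argument this is always
  the case, whence \<open>\<kappa>\<^sub>1 = 0\<close>.  With two fixed arguments it fails only if one of them sits in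
  \<open>{1, 4}\<close> and the other in \<open>{2, 3}\<close>; the group generated by \<open>H\<close> and \<open>(1 2)(3 4)\<close>, which leaves
  \<open>k\<close> invariant, acts simply transitively on these 8 placements, whence the formula for \<open>\<kappa>\<^sub>2\<close>.  The same
  vanishing shows that only pairs of index sets with two common elements contribute to the
  second moment of \<open>U\<close>, which is therefore \<open>O(n\<^sup>-\<^sup>2)\<close>.
\<close>

section \<open>Permutations and the signed sums\<close>

abbreviation transposition where "transposition \<equiv> Transposition.transpose"

lemma perm_act_transpose: "perm_act (transposition a b) w = w \<circ> transposition a b"
  by (simp add: perm_act_def fun_eq_iff)

lemma perm_act_id [simp]: "perm_act id w = w"
  by (simp add: perm_act_def)

lemma perm_act_comp:
  assumes "bij \<sigma>" "bij \<tau>"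
  shows "perm_act (\<sigma> \<circ> \<tau>) w = perm_act \<sigma> (perm_act \<tau> w)"
  using assms by (simp add: perm_act_def o_inv_distrib)

lemma transpose_in_sym_group:
  "a \<in> {1..m} \<Longrightarrow> b \<in> {1..m} \<Longrightarrow> transposition a b \<in> carrier (sym_group m)"
  by (simp add: sym_group_carrier permutes_swap_id)

text \<open>Makes it enough to test the generators of \<open>G_tau_star m\<close> when its inclusion
  in an invariance group is to be shown.\<close>

lemma subgroup_invariance_group: "subgroup (invariance_group m I) (sym_group m)"
proof
  show "invariance_group m I \<subseteq> carrier (sym_group m)"
    by (auto simp: invariance_group_def)
  show "\<one>\<^bsub>sym_group m\<^esub> \<in> invariance_group m I"
    by (simp add: invariance_group_def sym_group_one sym_group_carrier permutes_id)
next
  fix \<sigma> \<tau> assume "\<sigma> \<in> invariance_group m I" "\<tau> \<in> invariance_group m I"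
  then show "\<sigma> \<otimes>\<^bsub>sym_group m\<^esub> \<tau> \<in> invariance_group m I"
    by (auto simp: invariance_group_def sym_group_mult sym_group_carrier
        permutes_compose perm_act_comp permutes_bij)
next
  fix \<sigma> assume \<sigma>: "\<sigma> \<in> invariance_group m I"
  then have perm: "\<sigma> permutes {1..m}" by (simp add: invariance_group_def sym_group_carrier)
  have "I (perm_act (inv' \<sigma>) w) = I w" for w
  proof -
    \<comment> \<open>Invariance under \<open>\<sigma>\<close> is applied to the matrix
      \<open>perm_act (inv' \<sigma>) w\<close> and read backwards.\<close>
    have "I (perm_act (inv' \<sigma>) w) = I (perm_act \<sigma> (perm_act (inv' \<sigma>) w))"
      using \<sigma> by (simp add: invariance_group_def)
    also have "perm_act \<sigma> (perm_act (inv' \<sigma>) w) = w"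
      using perm by (simp flip: perm_act_comp
          add: permutes_bij permutes_inv[THEN permutes_bij] permutes_inv_o)
    finally show ?thesis .
  qed
  then show "inv\<^bsub>sym_group m\<^esub> \<sigma> \<in> invariance_group m I"
    using \<sigma> perm by (simp add: invariance_group_def sym_group_carrier permutes_inv)
qed

text \<open>Transpositions are involutions, so the inverse in \<open>perm_act\<close> disappears and
  the test of the two generators becomes plain composition on the right.\<close>

lemma G_tau_star_subset_invariance_group_iff:
  assumes "4 \<le> m"
  shows "G_tau_star m \<subseteq> invariance_group m I \<longleftrightarrow>
    (\<forall>w. I (w \<circ> transposition 1 2) = I w) \<and> (\<forall>w. I (w \<circ> transposition 3 4) = I w)" (is "_ \<longleftrightarrow> ?R")
proof -
  have "?R \<longleftrightarrow> {transposition 1 2, transposition 3 4} \<subseteq> invariance_group m I"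
    using assms by (auto simp: invariance_group_def perm_act_transpose transpose_in_sym_group)
  also have "\<dots> \<longleftrightarrow> G_tau_star m \<subseteq> invariance_group m I"
    unfolding G_tau_star_def
    using group.generate_subgroup_incl[OF sym_group_is_group _ subgroup_invariance_group]
    by (meson generate.incl subset_iff)
  finally show ?thesis ..
qed

lemma G_tau_star_subset_src_invariance_group_iff:
  "G_tau_star m \<subseteq> src_invariance_group m IX IY \<longleftrightarrow>
    G_tau_star m \<subseteq> invariance_group m IX \<and> G_tau_star m \<subseteq> invariance_group m IY"
  by (auto simp: src_invariance_group_def)

lemma transpose_14_23_commute: "transposition 1 4 \<circ> transposition 2 3 = transposition 2 3 \<circ> transposition 1 (4::nat)"
  by (rule swap_id_independent) auto

text \<open>Two disjoint transpositions are commuting involutions, so they generate a Klein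
  four-group; listing it turns sums over \<open>H_tau_star m\<close> into four explicit
  terms.\<close>

lemma H_tau_star_eq:
  assumes "4 \<le> m"
  shows "H_tau_star m = {id, transposition 1 4, transposition 2 3, transposition 1 4 \<circ> transposition 2 3}" (is "_ = ?H")
proof
  let ?G = "sym_group m"
  have H: "?H \<subseteq> carrier ?G"
    using assms by (auto simp: sym_group_carrier permutes_id permutes_swap_id permutes_compose)
  note sq = transpose_14_23_commute
  have inv_H: "inv' (transposition 1 4 \<circ> transposition 2 3) = transposition 1 4 \<circ> transposition 2 (3::nat)"
    by (subst o_inv_distrib) (simp_all add: sq del: One_nat_def)
  \<comment> \<open>Together with \<open>sq\<close> these rules bring every product into a normal
    form with \<open>transposition 1 4\<close> on the left and squares cancelled, which decides
    closure.\<close>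
  have comp: "transposition 1 4 \<circ> (transposition 1 4 \<circ> p) = p" "transposition 2 3 \<circ> (transposition 2 3 \<circ> p) = p"
    for p :: "nat \<Rightarrow> nat"
    by (simp_all flip: comp_assoc)
  have comp': "transposition 2 3 \<circ> (transposition 1 4 \<circ> p) = transposition 1 4 \<circ> (transposition 2 3 \<circ> p)" for p :: "nat \<Rightarrow> nat"
    using sq by (metis comp_assoc)
  have "subgroup ?H ?G"
  proof (rule group.subgroupI[OF sym_group_is_group H])
    show "?H \<noteq> {}" by simp
  next
    fix a assume a: "a \<in> ?H"
    with H have "inv\<^bsub>?G\<^esub> a = inv' a" by auto
    with a inv_H show "inv\<^bsub>?G\<^esub> a \<in> ?H" by auto
  next
    fix a b assume "a \<in> ?H" "b \<in> ?H"
    then show "a \<otimes>\<^bsub>?G\<^esub> b \<in> ?H"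
      by (auto simp: sym_group_mult comp_assoc comp comp' sq[symmetric] simp del: One_nat_def)
  qed
  then show "H_tau_star m \<subseteq> ?H"
    unfolding H_tau_star_def by (intro group.generate_subgroup_incl[OF sym_group_is_group]) auto
  show "?H \<subseteq> H_tau_star m"
    unfolding H_tau_star_def
    using generate.one[of ?G] generate.eng[of "transposition 1 4" ?G "{transposition 1 4, transposition 2 3}" "transposition 2 3"]
    by (auto intro: generate.incl simp: sym_group_one sym_group_mult simp del: One_nat_def)
qed

lemma signed_sum_H_tau_star:
  assumes "4 \<le> m"
  shows "signed_sum (H_tau_star m) I w =
    I w - I (w \<circ> transposition 1 4) - I (w \<circ> transposition 2 3) + I (w \<circ> transposition 1 4 \<circ> transposition 2 3)"
proof -
  \<comment> \<open>The images of 1 and 2 tell the four elements apart, so the sum over the set has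
    four separate terms.\<close>
  have "distinct (map (\<lambda>\<sigma>. (\<sigma> 1, \<sigma> 2)) [id, transposition 1 4, transposition 2 (3::nat), transposition 1 4 \<circ> transposition 2 3])"
    by (simp add: Transposition.transpose_def)
  then have "distinct [id, transposition 1 4, transposition 2 (3::nat), transposition 1 4 \<circ> transposition 2 3]"
    by (simp only: distinct_map)
  moreover have "perm_act (transposition 1 4 \<circ> transposition 2 3) w = w \<circ> transposition 1 4 \<circ> transposition 2 3"
    by (subst perm_act_comp) (simp_all add: perm_act_transpose comp_assoc transpose_14_23_commute del: One_nat_def)
  moreover have "sign (transposition 1 4 \<circ> transposition 2 (3::nat)) = 1"
    by (subst sign_compose) (simp_all add: sign_swap_id permutation_swap_id)
  ultimately show ?thesis
    unfolding signed_sum_def H_tau_star_eq[OF assms]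
    by (simp add: perm_act_transpose sign_swap_id del: One_nat_def)
qed

text \<open>Composing with a transposition from the group permutes the four terms of the signed sum
  and reverses each sign.\<close>

lemma signed_sum_swap:
  assumes "4 \<le> m" "(a, b) \<in> {(1, 4), (2, 3)}"
  shows "signed_sum (H_tau_star m) I (w \<circ> transposition a b) = - signed_sum (H_tau_star m) I w"
proof -
  have "w \<circ> transposition 2 3 \<circ> transposition 1 4 = w \<circ> transposition 1 4 \<circ> transposition 2 3"
    by (simp only: comp_assoc transpose_14_23_commute)
  moreover have "w \<circ> transposition 1 4 \<circ> transposition 2 3 \<circ> transposition 2 3 = w \<circ> transposition 1 4"
    "w \<circ> transposition 2 3 \<circ> transposition 2 3 = w" "w \<circ> transposition 1 4 \<circ> transposition 1 4 = w"
    by (simp_all add: comp_assoc)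
  ultimately show ?thesis
    using assms(2) by (auto simp: signed_sum_H_tau_star[OF assms(1)])
qed

text \<open>Conjugation by (1 2)(3 4) exchanges (1 4) and (2 3), so it normalises the group and only
  interchanges the two terms of negative sign. Neither (1 2) nor (3 4) normalises the group alone,
  hence the product.\<close>

lemma signed_sum_flip:
  assumes "4 \<le> m" and 1: "\<And>w. I (w \<circ> transposition 1 2) = I w" and 2: "\<And>w. I (w \<circ> transposition 3 4) = I w"
  shows "signed_sum (H_tau_star m) I (w \<circ> (transposition 1 2 \<circ> transposition 3 4)) = signed_sum (H_tau_star m) I w"
proof -
  let ?f = "transposition 1 2 \<circ> transposition 3 (4::nat)"
  have I: "I (w \<circ> ?f) = I w" for w
    using 1 2 by (simp flip: comp_assoc del: One_nat_def)
  have "w \<circ> ?f \<circ> transposition 1 4 = w \<circ> transposition 2 3 \<circ> ?f"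
    "w \<circ> ?f \<circ> transposition 2 3 = w \<circ> transposition 1 4 \<circ> ?f"
    "w \<circ> transposition 2 3 \<circ> ?f \<circ> transposition 2 3 = w \<circ> transposition 1 4 \<circ> transposition 2 3 \<circ> ?f"
    by (auto simp: fun_eq_iff Transposition.transpose_def)
  then show ?thesis
    by (simp add: signed_sum_H_tau_star[OF assms(1)] I del: One_nat_def)
qed

text \<open>Two terms enter with each sign and all lie in [0, 1], so the bound is 2 rather than
  4.\<close>

lemma abs_signed_sum_le:
  assumes "4 \<le> m" and "\<And>w. I w \<in> {0, 1}"
  shows "\<bar>signed_sum (H_tau_star m) I w\<bar> \<le> 2"
proof -
  have "0 \<le> I v \<and> I v \<le> 1" for v using assms(2)[of v] by auto
  from this[of w] this[of "w \<circ> transposition 1 4"] this[of "w \<circ> transposition 2 3"]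
    this[of "w \<circ> transposition 1 4 \<circ> transposition 2 3"]
  show ?thesis
    unfolding signed_sum_H_tau_star[OF assms(1)] by linarith
qed

section \<open>Joint ranks and the indicators of tau*, D and R\<close>

lemma joint_rank_le_iff:
  assumes "j \<in> {1..m}" "k \<in> {1..m}"
  shows "joint_rank m w j $ i \<le> joint_rank m w k $ i \<longleftrightarrow> w j $ i \<le> w k $ i"
proof -
  \<comment> \<open>\<open>r x\<close> counts the entries of row \<open>i\<close> below
    \<open>x\<close>. It is monotone, and strictly increasing past any value that occurs in the row,
    since a column attaining \<open>x\<close> is counted by \<open>r y\<close> and not by
    \<open>r x\<close>. Comparisons therefore survive ranking, ties included.\<close>
  define r where "r x = (\<Sum>l = 1..m. of_bool (w l $ i < x) :: real)" for x
  have "r x \<le> r y" if "x \<le> y" for x y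
    unfolding r_def using that by (intro sum_mono) auto
  moreover have "r x < r y" if "x < y" "\<exists>l\<in>{1..m}. w l $ i = x" for x y
    unfolding r_def using that by (intro sum_strict_mono_ex1) auto
  ultimately have "r (w j $ i) \<le> r (w k $ i) \<longleftrightarrow> w j $ i \<le> w k $ i"
    using assms by (metis not_le)
  then show ?thesis
    using assms by (simp add: joint_rank_def r_def)
qed

lemma joint_rank_less_iff:
  assumes "j \<in> {1..m}" "k \<in> {1..m}"
  shows "joint_rank m w j $ i < joint_rank m w k $ i \<longleftrightarrow> w j $ i < w k $ i"
  using joint_rank_le_iff[OF assms(2,1)] by (simp flip: not_le)

lemma rank_indicator_I_tau_star: "rank_indicator 4 I_tau_star"
  by (simp add: rank_indicator_def I_tau_star_def joint_rank_less_iff)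

lemma G_tau_star_I_tau_star: "G_tau_star 4 \<subseteq> invariance_group 4 I_tau_star"
  by (auto simp: G_tau_star_subset_invariance_group_iff I_tau_star_def Transposition.transpose_def)

lemma I_R_eq: "I_R p w = of_bool (w 1 \<le> (\<chi> i. w (p i) $ i) \<and> w 2 \<le> (\<chi> i. w (p i) $ i) \<and>
    \<not> w 3 \<le> (\<chi> i. w (p i) $ i) \<and> \<not> w 4 \<le> (\<chi> i. w (p i) $ i))"
  by (simp add: I_R_def Let_def)

lemma rank_indicator_I_R:
  assumes "4 \<le> m" "\<And>i. p i \<in> {1..m}"
  shows "rank_indicator m (I_R p)"
proof -
  have "I_R p (joint_rank m w) = I_R p w" for w
    using assms by (simp add: I_R_eq less_eq_vec_def joint_rank_le_iff)
  moreover have "I_R p w \<in> {0, 1}" for w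
    unfolding I_R_eq of_bool_def by simp
  ultimately show ?thesis by (simp add: rank_indicator_def)
qed

text \<open>Both generators move only columns up to 4, so the comparison point stays put, and the
  indicator is symmetric in the columns 1, 2 and in the columns 3, 4.\<close>

lemma G_tau_star_I_R:
  assumes "4 \<le> m" "\<And>i. 4 < p i"
  shows "G_tau_star m \<subseteq> invariance_group m (I_R p)"
proof -
  have "p i \<notin> {1, 2, 3, 4}" for i using assms(2)[of i] by auto
  then show ?thesis
    using assms(1) by (auto simp: G_tau_star_subset_invariance_group_iff I_R_eq Transposition.transpose_def)
qed

text \<open>A constant choice of column turns the comparison point into a whole column; the results
  on \<open>I_R\<close> then cover \<open>I_D\<close>.\<close>

lemma I_D_eq_I_R: "I_D = I_R (\<lambda>_. 5)"
  by (simp add: fun_eq_iff I_D_def I_R_eq)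

section \<open>Counting arguments and symmetries of the kernel\<close>

lemma sum_straddling_permutations:
  fixes t :: real
  assumes "4 \<le> m"
  shows "(\<Sum>\<sigma> | \<sigma> permutes {1..m}.
      if \<sigma> 1 \<in> {1, 4} \<and> \<sigma> 2 \<in> {2, 3} \<or> \<sigma> 1 \<in> {2, 3} \<and> \<sigma> 2 \<in> {1, 4} then t else 0)
    = 8 * fact (m - 2) * t" (is "sum ?f _ = _")
proof -
  \<comment> \<open>Writing \<open>\<sigma>\<close> as
    \<open>transposition 1 b \<circ> (transposition 2 c \<circ> q)\<close> with \<open>q\<close>
    fixing 1 and 2 gives \<open>\<sigma> 1 = b\<close> and
    \<open>\<sigma> 2 = transposition 1 b c\<close>; \<open>?g b c\<close> is the summand in these
    terms.\<close>
  let ?g = "\<lambda>b c::nat. if b \<in> {1, 4} \<and> transposition 1 b c \<in> {2, 3} \<or> b \<in> {2, 3} \<and> transposition 1 b c \<in> {1, 4}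
    then t else 0"
  have ins: "{1..m} = insert 1 {2..m}" "{2..m} = insert 2 {3..m}" using assms by auto
  have f: "?f (transposition 1 b \<circ> (transposition 2 c \<circ> q)) = ?g b c"
    if "q permutes {3..m}" "c \<in> {2..m}" for b c :: nat and q
  proof -
    have "q 1 = 1" "q 2 = 2" using that(1) by (auto simp: permutes_def)
    with that(2) have "(transposition 1 b \<circ> (transposition 2 c \<circ> q)) 1 = b" "(transposition 1 b \<circ> (transposition 2 c \<circ> q)) 2 = transposition 1 b c"
      by auto
    then show ?thesis by presburger
  qed
  have "(\<Sum>\<sigma> | \<sigma> permutes {1..m}. ?f \<sigma>) =
      (\<Sum>b\<in>{1..m}. \<Sum>q | q permutes {2..m}. ?f (transposition 1 b \<circ> q))"
    unfolding ins(1) by (rule sum_over_permutations_insert) auto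
  also have "\<dots> = (\<Sum>b\<in>{1..m}. \<Sum>c\<in>{2..m}. \<Sum>q | q permutes {3..m}. ?f (transposition 1 b \<circ> (transposition 2 c \<circ> q)))"
    unfolding ins(2) by (intro sum.cong refl sum_over_permutations_insert) auto
  also have "\<dots> = (\<Sum>b\<in>{1..m}. \<Sum>c\<in>{2..m}. \<Sum>q | q permutes {3..m}. ?g b c)"
    using f by (intro sum.cong refl) blast
  also have "\<dots> = (\<Sum>b\<in>{1..m}. \<Sum>c\<in>{2..m}. fact (m - 2) * ?g b c)"
    using card_permutations[of "{3..m}" "m - 2"] assms by simp
  \<comment> \<open>For \<open>b\<close> beyond 4 neither alternative holds, and for
    \<open>b \<le> 4 < c\<close> the image of 2 is \<open>c\<close> itself. Among the 12 remaining
    pairs 8 straddle: two choices in each of {1, 4} and {2, 3}, in either order.\<close>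
  also have "\<dots> = (\<Sum>b\<in>{1,2,3,4}. \<Sum>c\<in>{2,3,4}. fact (m - 2) * ?g b c)"
  proof (rule sum.mono_neutral_cong_right)
    fix b :: nat assume "b \<in> {1,2,3,4}"
    show "(\<Sum>c\<in>{2..m}. fact (m - 2) * ?g b c) = (\<Sum>c\<in>{2,3,4}. fact (m - 2) * ?g b c)"
      using assms \<open>b \<in> _\<close>
      by (intro sum.mono_neutral_right) (auto simp: Transposition.transpose_def)
  qed (use assms in auto)
  also have "\<dots> = 8 * fact (m - 2) * t"
    by (simp add: Transposition.transpose_def)
  finally show ?thesis .
qed

text \<open>A transposition from \<open>H_tau_star m\<close> changes the sign of both factors of
  \<open>src_k\<close>, which cancels; (1 2)(3 4) changes neither. All three \<open>\<delta>\<close>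
  are involutions, so the inverse in \<open>perm_act\<close> disappears.\<close>

lemma src_k_perm_act:
  assumes m: "4 \<le> m" and G: "G_tau_star m \<subseteq> src_invariance_group m IX IY"
    and \<delta>: "\<delta> \<in> {transposition 1 4, transposition 2 3, transposition 1 2 \<circ> transposition 3 4}"
  shows "src_k (H_tau_star m) IX IY (perm_act \<delta> z) = src_k (H_tau_star m) IX IY z"
proof -
  have "inv' (transposition 1 2 \<circ> transposition 3 4) = transposition 1 2 \<circ> transposition 3 (4::nat)"
    by (subst o_inv_distrib) (auto intro: swap_id_independent)
  with \<delta> have "inv' \<delta> = \<delta>" by auto
  then have *: "(\<lambda>j. fst (perm_act \<delta> z j)) = (\<lambda>j. fst (z j)) \<circ> \<delta>"
    "(\<lambda>j. snd (perm_act \<delta> z j)) = (\<lambda>j. snd (z j)) \<circ> \<delta>"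
    by (simp_all add: perm_act_def fun_eq_iff)
  show ?thesis
    using \<delta> G signed_sum_flip[OF m, of IX] signed_sum_flip[OF m, of IY]
    unfolding src_k_def * G_tau_star_subset_src_invariance_group_iff
      G_tau_star_subset_invariance_group_iff[OF m]
    by (auto simp: signed_sum_swap[OF m] simp del: One_nat_def)
qed

text \<open>Translates a swap of two kernel positions into a swap of the two observations that
  occupy them.\<close>

lemma inj_on_transpose_apply:
  assumes "inj_on f A" "a \<in> A" "b \<in> A" "j \<in> A"
  shows "f (transposition a b j) = transposition (f a) (f b) (f j)"
  using assms by (auto simp: Transposition.transpose_def inj_on_eq_iff)

text \<open>Source of the factor n^(-2) in the second moment. A union bound over the four positions
  gives \<open>card A ^ 4\<close>; for fixed positions with \<open>q \<noteq> q'\<close>,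
  \<open>f\<close> is arbitrary and prescribes two values of \<open>g\<close>.\<close>

lemma card_sharing_two_values_le:
  assumes "finite A"
  shows "card {(f, g). f \<in> A \<rightarrow>\<^sub>E {1..n::nat} \<and> g \<in> A \<rightarrow>\<^sub>E {1..n} \<and>
      (\<exists>p\<in>A. \<exists>p'\<in>A. \<exists>q\<in>A. \<exists>q'\<in>A. q \<noteq> q' \<and> f p = g q \<and> f p' = g q')}
    \<le> card A ^ 4 * (n ^ card A * n ^ (card A - 2))" (is "card ?S \<le> _")
proof -
  let ?N = "A \<rightarrow>\<^sub>E {1..n}"
  let ?T = "\<lambda>(p, p', q, q'). {(f, g). f \<in> ?N \<and> g \<in> ?N \<and> q \<noteq> q' \<and> f p = g q \<and> f p' = g q'}"
  let ?I = "A \<times> A \<times> A \<times> A"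
  have fin: "finite (?N \<times> ?N)" using assms by (simp add: finite_PiE)
  have T: "card (?T t) \<le> n ^ card A * n ^ (card A - 2)" if "t \<in> ?I" for t
  proof -
    obtain p p' q q' where t: "t = (p, p', q, q')" "p \<in> A" "p' \<in> A" "q \<in> A" "q' \<in> A"
      using \<open>t \<in> ?I\<close> by auto
    show ?thesis
    proof (cases "q = q'")
      case False
      let ?r = "\<lambda>(f, g). (f, restrict g (A - {q, q'})) :: ('a \<Rightarrow> nat) \<times> ('a \<Rightarrow> nat)"
      let ?R = "?N \<times> ((A - {q, q'}) \<rightarrow>\<^sub>E {1..n})"
      \<comment> \<open>\<open>f\<close> and the values of \<open>g\<close> off
        \<open>{q, q'}\<close> determine the pair: \<open>g q = f p\<close>,
        \<open>g q' = f p'\<close>, and \<open>g\<close> is \<open>undefined\<close> off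
        \<open>A\<close>.\<close>
      have "inj_on ?r (?T t)"
      proof (rule inj_onI)
        fix u v assume uv: "u \<in> ?T t" "v \<in> ?T t" and eq: "?r u = ?r v"
        obtain f g f' g' where fg: "u = (f, g)" "v = (f', g')" by (cases u, cases v) auto
        have "f = f'" and g: "restrict g (A - {q, q'}) = restrict g' (A - {q, q'})"
          using eq by (simp_all add: fg)
        have vals: "g \<in> ?N" "g' \<in> ?N" "f p = g q" "f p' = g q'" "f' p = g' q" "f' p' = g' q'"
          using uv by (simp_all add: fg t)
        have "g x = g' x" for x
        proof (cases "x \<in> A - {q, q'}")
          case True then show ?thesis using fun_cong[OF g, of x] by simp
        next
          case False
          then consider "x = q" | "x = q'" | "x \<notin> A" by auto
          then show ?thesis
            using vals \<open>f = f'\<close> PiE_arb[OF vals(1)] PiE_arb[OF vals(2)] by cases metis+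
        qed
        then have "g = g'" ..
        then show "u = v" using \<open>f = f'\<close> by (simp add: fg)
      qed
      moreover have "?r ` ?T t \<subseteq> ?R"
      proof
        fix v assume "v \<in> ?r ` ?T t"
        then obtain f g where v: "v = (f, restrict g (A - {q, q'}))" and fg: "f \<in> ?N" "g \<in> ?N"
          unfolding t by auto
        have "restrict g (A - {q, q'}) \<in> (A - {q, q'}) \<rightarrow>\<^sub>E {1..n}"
          unfolding restrict_PiE_iff using PiE_mem[OF fg(2)] by blast
        then show "v \<in> ?R" using fg(1) by (simp only: v mem_Times_iff fst_conv snd_conv)
      qed
      moreover have "finite ?R" using assms by (simp add: finite_PiE)
      ultimately have "card (?T t) \<le> card ?R" by (rule card_inj_on_le)
      also have "card ?R = n ^ card A * n ^ (card A - 2)"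
        using assms False t by (simp add: card_cartesian_product card_funcsetE card_Diff_subset numeral_2_eq_2)
      finally show ?thesis .
    qed (simp add: t)
  qed
  have "?S \<subseteq> (\<Union>t\<in>?I. ?T t)" by auto
  moreover have "finite (\<Union>t\<in>?I. ?T t)"
    by (rule finite_subset[OF _ fin]) auto
  ultimately have "card ?S \<le> card (\<Union>t\<in>?I. ?T t)" by (intro card_mono)
  also have "\<dots> \<le> (\<Sum>t\<in>?I. card (?T t))" using assms by (intro card_UN_le) auto
  also have "\<dots> \<le> (\<Sum>t\<in>?I. n ^ card A * n ^ (card A - 2))" using T by (rule sum_mono)
  also have "\<dots> = card A ^ 4 * (n ^ card A * n ^ (card A - 2))"
    by (simp add: card_cartesian_product power4_eq_xxxx mult.assoc)
  finally show ?thesis .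
qed

section \<open>Independent observations\<close>

text \<open>Points of the product space over \<open>I\<close> are \<open>undefined\<close> outside
  \<open>I\<close>, whereas kernels are applied to total sequences; the second conjunct bridges the
  two.\<close>

definition depends_measurably :: "nat set \<Rightarrow> ((nat \<Rightarrow> 'b::topological_space) \<Rightarrow> real) \<Rightarrow> bool" where
  "depends_measurably I F \<longleftrightarrow>
    F \<in> borel_measurable (\<Pi>\<^sub>M j\<in>I. borel) \<and> (\<forall>w. F (restrict w I) = F w)"

lemma depends_measurably_cong:
  assumes "depends_measurably I F" "\<And>j. j \<in> I \<Longrightarrow> v j = w j"
  shows "F v = F w"
proof -
  have "restrict v I = restrict w I" using assms(2) by (simp add: restrict_def fun_eq_iff)
  then show ?thesis using assms(1) unfolding depends_measurably_def by metis
qed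

lemma depends_measurably_compose:
  assumes F: "depends_measurably I F" and W: "\<And>j. j \<in> I \<Longrightarrow> W j \<in> borel_measurable N"
  shows "(\<lambda>\<omega>. F (\<lambda>j. W j \<omega>)) \<in> borel_measurable N"
proof -
  have "(\<lambda>\<omega>. \<lambda>j\<in>I. W j \<omega>) \<in> measurable N (\<Pi>\<^sub>M j\<in>I. borel)"
    by (rule measurable_restrict[OF W])
  moreover have "F \<in> borel_measurable (\<Pi>\<^sub>M j\<in>I. borel)"
    using F by (simp add: depends_measurably_def)
  ultimately have "(\<lambda>\<omega>. F (\<lambda>j\<in>I. W j \<omega>)) \<in> borel_measurable N"
    by (rule measurable_compose)
  also have "(\<lambda>\<omega>. F (\<lambda>j\<in>I. W j \<omega>)) = (\<lambda>\<omega>. F (\<lambda>j. W j \<omega>))"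
    by (intro ext depends_measurably_cong[OF F]) simp
  finally show ?thesis .
qed

text \<open>Each argument of \<open>F\<close> may be any measurable function of a single coordinate.
  Constants cover arguments that are held fixed, and \<open>fst\<close>, \<open>snd\<close> cover
  the two halves of an observation.\<close>

lemma depends_measurably_subst:
  assumes F: "depends_measurably I F"
    and V: "\<And>j. j \<in> I \<Longrightarrow> \<exists>l\<in>J. \<exists>f\<in>borel_measurable borel. \<forall>x. V x j = f (x l)"
  shows "depends_measurably J (\<lambda>x. F (V x))"
  unfolding depends_measurably_def
proof (intro conjI allI)
  show "F (V (restrict x J)) = F (V x)" for x
  proof (rule depends_measurably_cong[OF F])
    fix j assume "j \<in> I"
    from V[OF this] show "V (restrict x J) j = V x j" by auto
  qed
  show "(\<lambda>x. F (V x)) \<in> borel_measurable (\<Pi>\<^sub>M j\<in>J. borel)"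
  proof (rule depends_measurably_compose[OF F])
    fix j assume "j \<in> I"
    from V[OF this] obtain l f where lf: "l \<in> J" "f \<in> borel_measurable borel" "\<And>x. V x j = f (x l)"
      by metis
    show "(\<lambda>x. V x j) \<in> borel_measurable (\<Pi>\<^sub>M j\<in>J. borel)"
      using measurable_compose[OF measurable_component_singleton[OF lf(1), of "\<lambda>_. borel"] lf(2)]
      by (simp add: lf(3))
  qed
qed

lemma depends_measurably_reindex:
  assumes F: "depends_measurably I F" and \<tau>: "\<And>j. j \<in> I \<Longrightarrow> \<tau> j \<in> J"
  shows "depends_measurably J (\<lambda>x. F (\<lambda>j. x (\<tau> j)))"
proof (rule depends_measurably_subst[OF F])
  fix j assume "j \<in> I"
  then show "\<exists>l\<in>J. \<exists>f\<in>borel_measurable borel. \<forall>x. x (\<tau> j) = f (x l)"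
    by (intro bexI[of _ "\<tau> j"] bexI[of _ "\<lambda>y. y"] \<tau>) auto
qed

lemma depends_measurably_mult:
  "depends_measurably I F \<Longrightarrow> depends_measurably I G \<Longrightarrow> depends_measurably I (\<lambda>w. F w * G w)"
  by (auto simp: depends_measurably_def intro: borel_measurable_times)

lemma depends_measurably_add:
  "depends_measurably I F \<Longrightarrow> depends_measurably I G \<Longrightarrow> depends_measurably I (\<lambda>w. F w + G w)"
  by (auto simp: depends_measurably_def intro: borel_measurable_add)

lemma depends_measurably_diff:
  "depends_measurably I F \<Longrightarrow> depends_measurably I G \<Longrightarrow> depends_measurably I (\<lambda>w. F w - G w)"
  by (auto simp: depends_measurably_def intro: borel_measurable_diff)

text \<open>Measurability comes from rank invariance: \<open>I\<close> factors through the finite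
  set of strict comparisons between entries of a row, and every function on a finite discrete space
  is measurable.\<close>

lemma rank_indicator_depends_measurably:
  fixes I :: "(nat \<Rightarrow> real ^ 'd) \<Rightarrow> real"
  assumes "rank_indicator m I"
  shows "depends_measurably {1..m} I"
proof -
  define K where "K = {1..m} \<times> {1..m} \<times> (UNIV :: 'd set)"
  define pattern where "pattern w = {(k, j, i). (k, j, i) \<in> K \<and> w k $ i < w j $ i}"
    for w :: "nat \<Rightarrow> real ^ 'd"
  \<comment> \<open>\<open>R\<close> rebuilds the joint rank matrix from the comparison
    pattern.\<close>
  define R where "R P = (\<lambda>j. \<chi> i. if j \<in> {1..m} then 1 + (\<Sum>k = 1..m. of_bool ((k, j, i) \<in> P)) else (0 :: real))"
    for P :: "(nat \<times> nat \<times> 'd) set"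
  have "R (pattern w) = joint_rank m w" for w
    by (auto simp: R_def pattern_def K_def joint_rank_def fun_eq_iff vec_eq_iff intro!: sum.cong)
  with assms have I: "I w = I (R (pattern w))" for w
    by (simp add: rank_indicator_def)
  let ?N = "\<Pi>\<^sub>M j\<in>{1..m}. (borel :: (real ^ 'd) measure)"
  have K: "finite K" by (simp add: K_def)
  have "pattern \<in> measurable ?N (count_space (Pow K))"
    unfolding measurable_count_space_eq2[OF finite_Pow_iff[THEN iffD2, OF K]]
  proof (intro conjI ballI)
    show "pattern \<in> space ?N \<rightarrow> Pow K" by (auto simp: pattern_def)
    fix P assume "P \<in> Pow K"
    moreover have "pattern w \<subseteq> K" for w by (auto simp: pattern_def)
    \<comment> \<open>A pattern is pinned down by finitely many comparisons, each of them a
      measurable event.\<close>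
    ultimately have "pattern -` {P} \<inter> space ?N = {w \<in> space ?N. \<forall>t\<in>K. (t \<in> pattern w) = (t \<in> P)}"
      by fast
    also have "\<dots> \<in> sets ?N"
      using K
    proof (intro sets.sets_Collect_finite_All)
      show "{w \<in> space ?N. (t \<in> pattern w) = (t \<in> P)} \<in> sets ?N"
        if "t \<in> K" for t
      proof -
        obtain k j i where t: "t = (k, j, i)" by (cases t)
        have [measurable]: "(\<lambda>w. w l $ i) \<in> borel_measurable ?N" if "l \<in> {1..m}" for l
          using measurable_compose[OF measurable_component_singleton[OF that, of "\<lambda>_. borel"]
            borel_measurable_continuous_onI[OF continuous_on_component[OF continuous_on_id]]] by simp
        have "k \<in> {1..m}" "j \<in> {1..m}" using that t by (auto simp: K_def)
        then have "{w \<in> space ?N. (w k $ i < w j $ i) = ((k, j, i) \<in> P)} \<in> sets ?N"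
          by measurable
        moreover have "(k, j, i) \<in> pattern w \<longleftrightarrow> w k $ i < w j $ i" for w
          using that t by (simp add: pattern_def)
        ultimately show ?thesis unfolding t by simp
      qed
    qed
    finally show "pattern -` {P} \<inter> space ?N \<in> sets ?N" .
  qed
  then have "(\<lambda>w. I (R (pattern w))) \<in> borel_measurable ?N"
    by (rule measurable_compose) simp
  then have "I \<in> borel_measurable ?N"
    by (simp only: I[symmetric])
  moreover have "I (restrict w {1..m}) = I w" for w
  proof -
    have "pattern (restrict w {1..m}) = pattern w"
      by (auto simp: pattern_def K_def)
    then show ?thesis by (simp only: I[of w] I[of "restrict w {1..m}"])
  qed
  ultimately show ?thesis
    unfolding depends_measurably_def by blast
qed

section \<open>Samples of pairs with independent coordinates\<close>

locale iid_pairs = prob_space M for M :: "'a measure" +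
  fixes X :: "'a \<Rightarrow> 'b::second_countable_topology" and Y :: "'a \<Rightarrow> 'c::second_countable_topology"
    and Z :: "nat \<Rightarrow> 'a \<Rightarrow> 'b \<times> 'c"
  assumes indep_XY: "independent_rvs M X Y"
    and indep_Z: "indep_vars (\<lambda>_. borel) Z {1..}"
    and distr_Z: "1 \<le> i \<Longrightarrow> distr M borel (Z i) = distr M borel (\<lambda>\<omega>. (X \<omega>, Y \<omega>))"
begin

lemma measurable_XY [measurable]: "X \<in> borel_measurable M" "Y \<in> borel_measurable M"
  using indep_XY by (auto simp: independent_rvs_def)

lemma measurable_Z: "1 \<le> i \<Longrightarrow> Z i \<in> borel_measurable M"
  using indep_Z by (auto simp: indep_vars_def)

lemma measurable_fst_Z: "1 \<le> i \<Longrightarrow> (\<lambda>\<omega>. fst (Z i \<omega>)) \<in> borel_measurable M"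
  and measurable_snd_Z: "1 \<le> i \<Longrightarrow> (\<lambda>\<omega>. snd (Z i \<omega>)) \<in> borel_measurable M"
  using measurable_Z[of i] by (auto simp flip: borel_prod)

text \<open>Independence of \<open>X\<close> and \<open>Y\<close> reaches each \<open>Z i\<close>
  through the equality of laws.\<close>

lemma prob_Z_in_Times:
  assumes i: "1 \<le> i" and A: "A \<in> sets borel" and B: "B \<in> sets borel"
  shows "prob (Z i -` (A \<times> B) \<inter> space M) = prob (X -` A \<inter> space M) * prob (Y -` B \<inter> space M)"
proof -
  \<comment> \<open>Second countability enters here: it makes the Borel sets of the product the
    product sigma-algebra.\<close>
  have AB: "A \<times> B \<in> sets borel" using A B by (simp flip: borel_prod)
  have "prob (Z i -` (A \<times> B) \<inter> space M) = measure (distr M borel (Z i)) (A \<times> B)"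
    using measurable_Z[OF i] AB by (simp add: measure_distr)
  also have "\<dots> = prob ((\<lambda>\<omega>. (X \<omega>, Y \<omega>)) -` (A \<times> B) \<inter> space M)"
    unfolding distr_Z[OF i] using AB by (intro measure_distr) (auto simp flip: borel_prod)
  also have "(\<lambda>\<omega>. (X \<omega>, Y \<omega>)) -` (A \<times> B) \<inter> space M = (X -` A \<inter> space M) \<inter> (Y -` B \<inter> space M)"
    by auto
  also have "prob \<dots> = prob (X -` A \<inter> space M) * prob (Y -` B \<inter> space M)"
    using indep_XY A B unfolding independent_rvs_def by (intro indep_setD) auto
  finally show ?thesis .
qed

lemma distr_fst_Z: "1 \<le> i \<Longrightarrow> distr M borel (\<lambda>\<omega>. fst (Z i \<omega>)) = distr M borel X"
  and distr_snd_Z: "1 \<le> i \<Longrightarrow> distr M borel (\<lambda>\<omega>. snd (Z i \<omega>)) = distr M borel Y"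
proof -
  assume i: "1 \<le> i"
  have Z: "Z i \<in> borel_measurable M" by (rule measurable_Z[OF i])
  have fs: "fst \<in> borel_measurable (borel :: ('b \<times> 'c) measure)" "snd \<in> borel_measurable (borel :: ('b \<times> 'c) measure)"
    by (simp_all flip: borel_prod)
  have XY: "(\<lambda>\<omega>. (X \<omega>, Y \<omega>)) \<in> borel_measurable M"
    by (simp flip: borel_prod)
  show "distr M borel (\<lambda>\<omega>. fst (Z i \<omega>)) = distr M borel X"
    using arg_cong[OF distr_Z[OF i], of "\<lambda>D. distr D borel fst"]
    by (simp add: distr_distr[OF fs(1) Z] distr_distr[OF fs(1) XY] comp_def)
  show "distr M borel (\<lambda>\<omega>. snd (Z i \<omega>)) = distr M borel Y"
    using arg_cong[OF distr_Z[OF i], of "\<lambda>D. distr D borel snd"]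
    by (simp add: distr_distr[OF fs(2) Z] distr_distr[OF fs(2) XY] comp_def)
qed

abbreviation X_tuple :: "nat set \<Rightarrow> 'a \<Rightarrow> nat \<Rightarrow> 'b" where
  "X_tuple I \<omega> \<equiv> \<lambda>j\<in>I. fst (Z j \<omega>)"

abbreviation Y_tuple :: "nat set \<Rightarrow> 'a \<Rightarrow> nat \<Rightarrow> 'c" where
  "Y_tuple I \<omega> \<equiv> \<lambda>j\<in>I. snd (Z j \<omega>)"

lemma measurable_X_tuple:
  "I \<subseteq> {1..} \<Longrightarrow> X_tuple I \<in> measurable M (\<Pi>\<^sub>M j\<in>I. borel)"
  and measurable_Y_tuple:
  "I \<subseteq> {1..} \<Longrightarrow> Y_tuple I \<in> measurable M (\<Pi>\<^sub>M j\<in>I. borel)"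
  by (auto intro!: measurable_restrict measurable_fst_Z measurable_snd_Z)

text \<open>Independence across observations, and within each between its two coordinates, makes the
  \<open>2 * card I\<close> coordinate families jointly independent; grouping them by coordinate
  yields one sigma-algebra for the X-sample and one for the Y-sample.\<close>

lemma prob_tuples:
  assumes I: "finite I" "I \<noteq> {}" "I \<subseteq> {1..}"
    and A: "A \<in> sets (\<Pi>\<^sub>M j\<in>I. borel)" and B: "B \<in> sets (\<Pi>\<^sub>M j\<in>I. borel)"
  shows "prob ((X_tuple I -` A \<inter> space M) \<inter> (Y_tuple I -` B \<inter> space M)) =
    prob (X_tuple I -` A \<inter> space M) * prob (Y_tuple I -` B \<inter> space M)"
proof -
  \<comment> \<open>The index pairs a Boolean, \<open>True\<close> for the X-coordinate, with an
    observation number.\<close>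
  define E where "E = (\<lambda>(b, j). if b
     then {(\<lambda>\<omega>. fst (Z j \<omega>)) -` A \<inter> space M | A. A \<in> sets borel}
     else {(\<lambda>\<omega>. snd (Z j \<omega>)) -` A \<inter> space M | A. A \<in> sets borel})"
  define S where "S b = sigma_sets (space M) (\<Union>t\<in>{b} \<times> I. E t)" for b
  have E: "E (True, j) = {(\<lambda>\<omega>. fst (Z j \<omega>)) -` A \<inter> space M | A. A \<in> sets borel}"
    "E (False, j) = {(\<lambda>\<omega>. snd (Z j \<omega>)) -` A \<inter> space M | A. A \<in> sets borel}" for j
    by (simp_all add: E_def)
  have I1: "1 \<le> j" if "j \<in> I" for j using that I by auto
  have E_events: "E t \<subseteq> events" if "t \<in> UNIV \<times> I" for t
  proof -
    obtain b j where t: "t = (b, j)" "j \<in> I" using \<open>t \<in> _\<close> by auto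
    show ?thesis
      unfolding t using measurable_sets[OF measurable_fst_Z[OF I1[OF t(2)]]]
        measurable_sets[OF measurable_snd_Z[OF I1[OF t(2)]]]
      by (cases b) (auto simp: E)
  qed
  have "indep_sets E (UNIV \<times> I)"
  proof (subst indep_sets_finite)
    show "UNIV \<times> I \<noteq> {}" "finite ((UNIV :: bool set) \<times> I)" using I by auto
    show "\<And>t. t \<in> UNIV \<times> I \<Longrightarrow> E t \<subseteq> events" by (rule E_events)
    \<comment> \<open>Each family contains the whole space, so the product formula need only be
      tested on full choices \<open>C\<close>.\<close>
    show "space M \<in> E t" for t
      by (cases t) (auto simp: E_def intro!: exI[of _ UNIV])
    show "\<forall>C\<in>Pi (UNIV \<times> I) E. prob (\<Inter>t\<in>UNIV \<times> I. C t) = (\<Prod>t\<in>UNIV \<times> I. prob (C t))"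
    proof
      fix C assume C: "C \<in> Pi (UNIV \<times> I) E"
      have "\<exists>A. A \<in> sets borel \<and> C (True, j) = (\<lambda>\<omega>. fst (Z j \<omega>)) -` A \<inter> space M" if "j \<in> I" for j
        using Pi_mem[OF C, of "(True, j)"] that by (auto simp: E)
      then obtain A where A: "\<And>j. j \<in> I \<Longrightarrow> A j \<in> sets borel"
        "\<And>j. j \<in> I \<Longrightarrow> C (True, j) = (\<lambda>\<omega>. fst (Z j \<omega>)) -` A j \<inter> space M"
        by metis
      have "\<exists>B. B \<in> sets borel \<and> C (False, j) = (\<lambda>\<omega>. snd (Z j \<omega>)) -` B \<inter> space M" if "j \<in> I" for j
        using Pi_mem[OF C, of "(False, j)"] that by (auto simp: E)
      then obtain B where B: "\<And>j. j \<in> I \<Longrightarrow> B j \<in> sets borel"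
        "\<And>j. j \<in> I \<Longrightarrow> C (False, j) = (\<lambda>\<omega>. snd (Z j \<omega>)) -` B j \<inter> space M"
        by metis
      have "(\<Inter>t\<in>UNIV \<times> I. C t) = (\<Inter>j\<in>I. C (True, j) \<inter> C (False, j))"
        by (auto simp: UNIV_bool)
      also have "\<dots> = (\<Inter>j\<in>I. Z j -` (A j \<times> B j) \<inter> space M)"
        by (intro INF_cong refl) (auto simp: A(2) B(2) mem_Times_iff)
      also have "prob \<dots> = (\<Prod>j\<in>I. prob (Z j -` (A j \<times> B j) \<inter> space M))"
      proof (rule indep_varsD[OF indep_Z])
        show "A j \<times> B j \<in> sets borel" if "j \<in> I" for j
          using A(1)[OF that] B(1)[OF that] by (simp flip: borel_prod)
      qed (use I in auto)
      also have "\<dots> = (\<Prod>j\<in>I. prob (C (True, j)) * prob (C (False, j)))"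
      proof (rule prod.cong[OF refl])
        fix j assume j: "j \<in> I"
        \<comment> \<open>The choice \<open>UNIV\<close> for the other coordinate recovers the
          marginal probabilities.\<close>
        have "prob (C (True, j)) = prob (X -` A j \<inter> space M)"
          unfolding A(2)[OF j] using prob_Z_in_Times[OF I1[OF j] A(1)[OF j], of UNIV] prob_space
          by (simp add: vimage_Times vimage_def mem_Times_iff)
        moreover have "prob (C (False, j)) = prob (Y -` B j \<inter> space M)"
          unfolding B(2)[OF j] using prob_Z_in_Times[OF I1[OF j] _ B(1)[OF j], of UNIV] prob_space
          by (simp add: vimage_Times vimage_def mem_Times_iff)
        ultimately show "prob (Z j -` (A j \<times> B j) \<inter> space M) = prob (C (True, j)) * prob (C (False, j))"
          using prob_Z_in_Times[OF I1[OF j] A(1)[OF j] B(1)[OF j]] by simp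
      qed
      also have "\<dots> = (\<Prod>t\<in>UNIV \<times> I. prob (C t))"
        unfolding prod.cartesian_product[symmetric, of "\<lambda>b j. prob (C (b, j))", simplified]
        by (simp add: UNIV_bool prod.distrib mult.commute)
      finally show "prob (\<Inter>t\<in>UNIV \<times> I. C t) = (\<Prod>t\<in>UNIV \<times> I. prob (C t))" .
    qed
  qed
  \<comment> \<open>Stability under intersections carries independence from the generators over to
    the grouped sigma-algebras \<open>S\<close>.\<close>
  moreover have "Int_stable (E t)" for t
  proof -
    have stable: "Int_stable {f -` A \<inter> space M | A. A \<in> sets N}" for f :: "'a \<Rightarrow> 'z" and N
    proof (rule Int_stableI)
      fix a b assume "a \<in> {f -` A \<inter> space M | A. A \<in> sets N}" "b \<in> {f -` A \<inter> space M | A. A \<in> sets N}"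
      then obtain A B where "a = f -` A \<inter> space M" "A \<in> sets N" "b = f -` B \<inter> space M" "B \<in> sets N"
        by auto
      then show "a \<inter> b \<in> {f -` A \<inter> space M | A. A \<in> sets N}"
        by (intro CollectI exI[of _ "A \<inter> B"]) auto
    qed
    then show ?thesis by (cases t) (simp add: E_def stable)
  qed
  moreover have "(\<Union>b\<in>(UNIV :: bool set). {b} \<times> I) = UNIV \<times> I" by auto
  ultimately have indep: "indep_sets S UNIV"
    unfolding S_def by (intro indep_sets_collect_sigma) (auto simp: disjoint_family_on_def)
  have gen: "(\<Union>t\<in>{b} \<times> I. E t) \<subseteq> Pow (space M)" for b
    using E_events sets.space_closed by blast
  have basic: "f -` A \<inter> space M \<in> S b" if "f -` A \<inter> space M \<in> E (b, j)" "j \<in> I"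
    for f :: "'a \<Rightarrow> 'z" and A b j
    using that unfolding S_def by (intro sigma_sets.Basic) auto
  have sp: "space (sigma (space M) (\<Union>t\<in>{b} \<times> I. E t)) = space M"
    "sets (sigma (space M) (\<Union>t\<in>{b} \<times> I. E t)) = S b" for b
    unfolding S_def using gen[of b] by (simp_all only: space_measure_of sets_measure_of)
  \<comment> \<open>Measurability is shown for the smaller sigma-algebra generated by the
    X-coordinates, which is what places the event in \<open>S True\<close>.\<close>
  have "X_tuple I \<in> measurable (sigma (space M) (\<Union>t\<in>{True} \<times> I. E t)) (\<Pi>\<^sub>M j\<in>I. borel)"
  proof (intro measurable_restrict measurableI, unfold sp)
    show "(\<lambda>\<omega>. fst (Z j \<omega>)) -` A \<inter> space M \<in> S True" if "j \<in> I" "A \<in> sets borel" for j A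
      using that by (intro basic[of _ _ _ j]) (auto simp: E)
  qed simp
  from measurable_sets[OF this A] have 1: "X_tuple I -` A \<inter> space M \<in> S True"
    by (simp only: sp)
  have "Y_tuple I \<in> measurable (sigma (space M) (\<Union>t\<in>{False} \<times> I. E t)) (\<Pi>\<^sub>M j\<in>I. borel)"
  proof (intro measurable_restrict measurableI, unfold sp)
    show "(\<lambda>\<omega>. snd (Z j \<omega>)) -` A \<inter> space M \<in> S False" if "j \<in> I" "A \<in> sets borel" for j A
      using that by (intro basic[of _ _ _ j]) (auto simp: E)
  qed simp
  from measurable_sets[OF this B] have 2: "Y_tuple I -` B \<inter> space M \<in> S False"
    by (simp only: sp)
  show ?thesis
    using indep_setsD[OF indep, of UNIV "case_bool (X_tuple I -` A \<inter> space M) (Y_tuple I -` B \<inter> space M)"] 1 2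
    by (simp add: UNIV_bool Int_ac mult_ac all_bool_eq)
qed

lemma distr_X_tuple:
  assumes I: "finite I" "I \<noteq> {}" "I \<subseteq> {1..}"
  shows "distr M (\<Pi>\<^sub>M j\<in>I. borel) (X_tuple I) = (\<Pi>\<^sub>M j\<in>I. distr M borel X)"
proof -
  have "indep_vars (\<lambda>_. borel) (\<lambda>j \<omega>. fst (Z j \<omega>)) I"
    by (rule indep_vars_compose2[OF indep_vars_subset[OF indep_Z I(3)]]) (simp flip: borel_prod)
  then have "distr M (\<Pi>\<^sub>M j\<in>I. borel) (X_tuple I) = (\<Pi>\<^sub>M j\<in>I. distr M borel (\<lambda>\<omega>. fst (Z j \<omega>)))"
    using I by (subst (asm) indep_vars_iff_distr_eq_PiM') (use I in \<open>auto intro!: measurable_fst_Z\<close>)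
  also have "\<dots> = (\<Pi>\<^sub>M j\<in>I. distr M borel X)"
    using I by (intro PiM_cong) (auto simp: distr_fst_Z)
  finally show ?thesis .
qed

lemma distr_Y_tuple:
  assumes I: "finite I" "I \<noteq> {}" "I \<subseteq> {1..}"
  shows "distr M (\<Pi>\<^sub>M j\<in>I. borel) (Y_tuple I) = (\<Pi>\<^sub>M j\<in>I. distr M borel Y)"
proof -
  have "indep_vars (\<lambda>_. borel) (\<lambda>j \<omega>. snd (Z j \<omega>)) I"
    by (rule indep_vars_compose2[OF indep_vars_subset[OF indep_Z I(3)]]) (simp flip: borel_prod)
  then have "distr M (\<Pi>\<^sub>M j\<in>I. borel) (Y_tuple I) = (\<Pi>\<^sub>M j\<in>I. distr M borel (\<lambda>\<omega>. snd (Z j \<omega>)))"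
    using I by (subst (asm) indep_vars_iff_distr_eq_PiM') (use I in \<open>auto intro!: measurable_snd_Z\<close>)
  also have "\<dots> = (\<Pi>\<^sub>M j\<in>I. distr M borel Y)"
    using I by (intro PiM_cong) (auto simp: distr_snd_Z)
  finally show ?thesis .
qed

text \<open>Rectangles determine the law, and on them it factors by \<open>prob_tuples\<close>. Each
  factor is a power of a single law, so the two samples can be permuted separately.\<close>

lemma distr_tuples:
  assumes I: "finite I" "I \<noteq> {}" "I \<subseteq> {1..}"
  shows "distr M ((\<Pi>\<^sub>M j\<in>I. borel) \<Otimes>\<^sub>M (\<Pi>\<^sub>M j\<in>I. borel)) (\<lambda>\<omega>. (X_tuple I \<omega>, Y_tuple I \<omega>)) =
    (\<Pi>\<^sub>M j\<in>I. distr M borel X) \<Otimes>\<^sub>M (\<Pi>\<^sub>M j\<in>I. distr M borel Y)"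
proof -
  note meas = measurable_X_tuple[OF I(3)] measurable_Y_tuple[OF I(3)]
  show ?thesis
    unfolding distr_X_tuple[OF I, symmetric] distr_Y_tuple[OF I, symmetric]
  proof (rule pair_measure_eqI[symmetric])
    show "sigma_finite_measure (distr M (\<Pi>\<^sub>M j\<in>I. borel) (X_tuple I))"
      "sigma_finite_measure (distr M (\<Pi>\<^sub>M j\<in>I. borel) (Y_tuple I))"
      using meas by (auto intro!: prob_space_imp_sigma_finite prob_space_distr)
  next
    fix A B assume AB: "A \<in> sets (distr M (\<Pi>\<^sub>M j\<in>I. borel) (X_tuple I))"
      "B \<in> sets (distr M (\<Pi>\<^sub>M j\<in>I. borel) (Y_tuple I))"
    have "(\<lambda>\<omega>. (X_tuple I \<omega>, Y_tuple I \<omega>)) -` (A \<times> B) \<inter> space M =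
      (X_tuple I -` A \<inter> space M) \<inter> (Y_tuple I -` B \<inter> space M)" by auto
    with AB prob_tuples[OF I, of A B] meas
    show "emeasure (distr M (\<Pi>\<^sub>M j\<in>I. borel) (X_tuple I)) A *
        emeasure (distr M (\<Pi>\<^sub>M j\<in>I. borel) (Y_tuple I)) B =
      emeasure (distr M ((\<Pi>\<^sub>M j\<in>I. borel) \<Otimes>\<^sub>M (\<Pi>\<^sub>M j\<in>I. borel)) (\<lambda>\<omega>. (X_tuple I \<omega>, Y_tuple I \<omega>))) (A \<times> B)"
      by (subst (1 2 3) emeasure_distr) (auto simp: emeasure_eq_measure ennreal_mult)
  qed simp
qed

text \<open>The joint law is a product of two power measures, each invariant under its own
  reindexing; this is why \<open>\<pi>\<close> and \<open>\<rho>\<close> may differ.\<close>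

lemma expectation_permute:
  assumes I: "finite I" "I \<noteq> {}" "I \<subseteq> {1..}" and F: "depends_measurably I F"
    and \<pi>: "\<pi> permutes I" and \<rho>: "\<rho> permutes I"
  shows "expectation (\<lambda>\<omega>. F (\<lambda>j. (fst (Z (\<pi> j) \<omega>), snd (Z (\<rho> j) \<omega>)))) = expectation (\<lambda>\<omega>. F (\<lambda>j. Z j \<omega>))"
proof -
  let ?B = "\<Pi>\<^sub>M j\<in>I. (borel :: 'b measure)" and ?C = "\<Pi>\<^sub>M j\<in>I. (borel :: 'c measure)"
  let ?P = "\<Pi>\<^sub>M j\<in>I. distr M borel X" and ?Q = "\<Pi>\<^sub>M j\<in>I. distr M borel Y"
  let ?T = "\<lambda>\<omega>. (X_tuple I \<omega>, Y_tuple I \<omega>)"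
  \<comment> \<open>\<open>\<phi>\<close> reindexes the two tuples separately, and \<open>G\<close>
    reads \<open>F\<close> as a function of the two tuples; the claim is a change of variables along
    \<open>\<phi>\<close>.\<close>
  define \<phi> :: "(nat \<Rightarrow> 'b) \<times> (nat \<Rightarrow> 'c) \<Rightarrow> _" where "\<phi> = (\<lambda>(x, y). (\<lambda>j\<in>I. x (\<pi> j), \<lambda>j\<in>I. y (\<rho> j)))"
  define G where "G t = F (\<lambda>j. (fst t j, snd t j))" for t
  have sets: "sets (?P \<Otimes>\<^sub>M ?Q) = sets (?B \<Otimes>\<^sub>M ?C)"
    by (intro sets_pair_measure_cong sets_PiM_cong) auto
  have T: "?T \<in> measurable M (?B \<Otimes>\<^sub>M ?C)"
    using measurable_X_tuple[OF I(3)] measurable_Y_tuple[OF I(3)] by (rule measurable_Pair)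
  have G: "G \<in> borel_measurable (?B \<Otimes>\<^sub>M ?C)"
    unfolding G_def
  proof (rule depends_measurably_compose[OF F])
    fix j assume "j \<in> I"
    then show "(\<lambda>t. (fst t j, snd t j)) \<in> borel_measurable (?B \<Otimes>\<^sub>M ?C)"
      unfolding borel_prod[symmetric] by measurable
  qed
  have perm: "\<pi> \<in> I \<rightarrow> I" "\<rho> \<in> I \<rightarrow> I" "inj_on \<pi> I" "inj_on \<rho> I"
    using \<pi> \<rho> by (auto simp: permutes_in_image permutes_inj_on)
  have ps: "prob_space (distr M borel X)" "prob_space (distr M borel Y)"
    by (auto intro: prob_space_distr)
  have P: "distr ?P ?P (\<lambda>x. \<lambda>j\<in>I. x (\<pi> j)) = ?P" and Q: "distr ?Q ?Q (\<lambda>y. \<lambda>j\<in>I. y (\<rho> j)) = ?Q"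
    using distr_PiM_reindex[of I "\<lambda>_. distr M borel X" \<pi> I] distr_PiM_reindex[of I "\<lambda>_. distr M borel Y" \<rho> I]
      ps perm by auto
  have mP: "(\<lambda>x. \<lambda>j\<in>I. x (\<pi> j)) \<in> measurable ?P ?P" and mQ: "(\<lambda>y. \<lambda>j\<in>I. y (\<rho> j)) \<in> measurable ?Q ?Q"
    using perm by (auto intro!: measurable_restrict measurable_component_singleton)
  have "sigma_finite_measure ?Q"
    by (intro prob_space_imp_sigma_finite prob_space_PiM ps)
  with pair_measure_distr[OF mP mQ] have inv: "distr (?P \<Otimes>\<^sub>M ?Q) (?P \<Otimes>\<^sub>M ?Q) \<phi> = ?P \<Otimes>\<^sub>M ?Q"
    unfolding P Q \<phi>_def by simp
  have m\<phi>: "\<phi> \<in> measurable (?P \<Otimes>\<^sub>M ?Q) (?P \<Otimes>\<^sub>M ?Q)"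
    unfolding \<phi>_def split_beta by (intro measurable_Pair
      measurable_compose[OF measurable_fst mP] measurable_compose[OF measurable_snd mQ])
  have G': "G \<in> borel_measurable (?P \<Otimes>\<^sub>M ?Q)"
    using G by (simp add: measurable_cong_sets[OF sets refl])
  have "expectation (\<lambda>\<omega>. F (\<lambda>j. (fst (Z (\<pi> j) \<omega>), snd (Z (\<rho> j) \<omega>)))) = expectation (\<lambda>\<omega>. G (\<phi> (?T \<omega>)))"
    using perm unfolding G_def \<phi>_def
    by (intro Bochner_Integration.integral_cong refl depends_measurably_cong[OF F]) auto
  also have "\<dots> = (\<integral>t. G (\<phi> t) \<partial>(?P \<Otimes>\<^sub>M ?Q))"
    unfolding distr_tuples[OF I, symmetric]
    using T m\<phi> G' by (intro integral_distr[symmetric]) (auto simp flip: measurable_cong_sets[OF sets refl])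
  also have "\<dots> = (\<integral>t. G t \<partial>(?P \<Otimes>\<^sub>M ?Q))"
    using integral_distr[OF m\<phi> G'] inv by simp
  also have "\<dots> = expectation (\<lambda>\<omega>. G (?T \<omega>))"
    unfolding distr_tuples[OF I, symmetric] by (rule integral_distr[OF T G])
  also have "\<dots> = expectation (\<lambda>\<omega>. F (\<lambda>j. Z j \<omega>))"
    unfolding G_def by (intro Bochner_Integration.integral_cong refl depends_measurably_cong[OF F]) auto
  finally show ?thesis .
qed

text \<open>Fubini for the product law of the two samples; the bound \<open>C\<close> supplies
  integrability.\<close>

lemma expectation_mult:
  assumes I: "finite I" "I \<noteq> {}" "I \<subseteq> {1..}"
    and g: "depends_measurably I g" "\<And>x. \<bar>g x\<bar> \<le> C"
    and h: "depends_measurably I h" "\<And>y. \<bar>h y\<bar> \<le> C"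
  shows "expectation (\<lambda>\<omega>. g (\<lambda>j. fst (Z j \<omega>)) * h (\<lambda>j. snd (Z j \<omega>))) =
    expectation (\<lambda>\<omega>. g (\<lambda>j. fst (Z j \<omega>))) * expectation (\<lambda>\<omega>. h (\<lambda>j. snd (Z j \<omega>)))"
proof -
  let ?B = "\<Pi>\<^sub>M j\<in>I. (borel :: 'b measure)" and ?C = "\<Pi>\<^sub>M j\<in>I. (borel :: 'c measure)"
  let ?P = "distr M ?B (X_tuple I)" and ?Q = "distr M ?C (Y_tuple I)"
  note mX = measurable_X_tuple[OF I(3)] and mY = measurable_Y_tuple[OF I(3)]
  interpret P: prob_space ?P by (rule prob_space_distr[OF mX])
  interpret Q: prob_space ?Q by (rule prob_space_distr[OF mY])
  interpret PQ: pair_prob_space ?P ?Q ..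
  have mg: "g \<in> borel_measurable ?B" and mh: "h \<in> borel_measurable ?C"
    using g h by (auto simp: depends_measurably_def)
  have mgh: "(\<lambda>(x, y). g x * h y) \<in> borel_measurable (?B \<Otimes>\<^sub>M ?C)"
    unfolding split_beta
    by (intro borel_measurable_times measurable_compose[OF measurable_fst mg] measurable_compose[OF measurable_snd mh])
  have [measurable]: "g \<in> borel_measurable ?P" "h \<in> borel_measurable ?Q"
    using mg mh by (simp_all cong: measurable_cong_sets)
  have gh: "g (X_tuple I \<omega>) = g (\<lambda>j. fst (Z j \<omega>))" "h (Y_tuple I \<omega>) = h (\<lambda>j. snd (Z j \<omega>))" for \<omega>
    by (auto intro!: depends_measurably_cong[OF g(1)] depends_measurably_cong[OF h(1)])
  have int: "integrable (?P \<Otimes>\<^sub>M ?Q) (\<lambda>(x, y). g x * h y)"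
  proof (rule PQ.P.integrable_const_bound[where B = "C * C"])
    show "AE t in ?P \<Otimes>\<^sub>M ?Q. norm (case t of (x, y) \<Rightarrow> g x * h y) \<le> C * C"
      using g(2) h(2) order_trans[OF abs_ge_zero g(2)]
      by (intro AE_I2) (auto simp: abs_mult intro!: mult_mono)
  qed measurable
  have "expectation (\<lambda>\<omega>. g (\<lambda>j. fst (Z j \<omega>)) * h (\<lambda>j. snd (Z j \<omega>))) =
      expectation (\<lambda>\<omega>. (\<lambda>(x, y). g x * h y) (X_tuple I \<omega>, Y_tuple I \<omega>))"
    by (simp add: gh)
  also have "\<dots> = (\<integral>t. (\<lambda>(x, y). g x * h y) t \<partial>(?P \<Otimes>\<^sub>M ?Q))"
    unfolding distr_X_tuple[OF I] distr_Y_tuple[OF I] distr_tuples[OF I, symmetric]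
    using mX mY mgh by (intro integral_distr[symmetric] measurable_Pair)
  also have "\<dots> = (\<integral>x. \<integral>y. g x * h y \<partial>?Q \<partial>?P)"
    using PQ.integral_fst'[OF int] by simp
  also have "\<dots> = (\<integral>x. g x \<partial>?P) * (\<integral>y. h y \<partial>?Q)"
    by simp
  also have "(\<integral>x. g x \<partial>?P) = expectation (\<lambda>\<omega>. g (X_tuple I \<omega>))"
    by (rule integral_distr[OF mX mg])
  also have "(\<integral>y. h y \<partial>?Q) = expectation (\<lambda>\<omega>. h (Y_tuple I \<omega>))"
    by (rule integral_distr[OF mY mh])
  finally show ?thesis by (simp only: gh)
qed

text \<open>Swapping only the X-parts of two observations preserves the law but negates
  \<open>F\<close>, so the expectation equals its own negative. All vanishing results below rest on
  this.\<close>

lemma expectation_eq_0_if_antisymmetric: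
  assumes J: "finite J" "J \<subseteq> {1..}" and F: "depends_measurably J F" and "c \<in> J" "d \<in> J"
    and anti: "\<And>w. F (\<lambda>j. (fst (w (transposition c d j)), snd (w j))) = - F w"
  shows "expectation (\<lambda>\<omega>. F (\<lambda>j. Z j \<omega>)) = 0"
proof -
  have "expectation (\<lambda>\<omega>. F (\<lambda>j. Z j \<omega>)) =
      expectation (\<lambda>\<omega>. F (\<lambda>j. (fst (Z (transposition c d j) \<omega>), snd (Z (id j) \<omega>))))"
    using assms by (intro expectation_permute[symmetric] permutes_swap_id permutes_id) auto
  also have "\<dots> = - expectation (\<lambda>\<omega>. F (\<lambda>j. Z j \<omega>))"
    using anti[of "\<lambda>j. Z j \<omega>" for \<omega>] by simp
  finally show ?thesis by simp
qed

end

section \<open>The kernel and its U-statistic\<close>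

locale tau_star_kernel = iid_pairs M X Y Z
  for M :: "'a measure" and X :: "'a \<Rightarrow> real ^ 'r" and Y :: "'a \<Rightarrow> real ^ 's" and Z +
  fixes m :: nat and IX :: "(nat \<Rightarrow> real ^ 'r) \<Rightarrow> real" and IY :: "(nat \<Rightarrow> real ^ 's) \<Rightarrow> real"
  assumes m: "4 \<le> m"
    and rank_IX: "rank_indicator m IX" and rank_IY: "rank_indicator m IY"
    and invariant: "G_tau_star m \<subseteq> src_invariance_group m IX IY"
begin

abbreviation "aX \<equiv> signed_sum (H_tau_star m) IX"
abbreviation "aY \<equiv> signed_sum (H_tau_star m) IY"
abbreviation "k \<equiv> src_k (H_tau_star m) IX IY"
abbreviation "\<kappa> \<equiv> src_kappa m (H_tau_star m) IX IY"

lemma abs_a_le: "\<bar>aX x\<bar> \<le> 2" "\<bar>aY y\<bar> \<le> 2"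
  using rank_IX rank_IY by (auto intro!: abs_signed_sum_le[OF m] simp: rank_indicator_def)

lemma abs_k_le: "\<bar>k z\<bar> \<le> 4"
  using mult_mono[OF abs_a_le(1) abs_a_le(2)] by (simp add: src_k_def abs_mult)

lemma abs_kappa_le: "\<bar>\<kappa> z\<bar> \<le> 4"
proof -
  have "\<bar>\<Sum>\<sigma>\<in>carrier (sym_group m). k (perm_act \<sigma> z)\<bar> \<le> (\<Sum>\<sigma>\<in>carrier (sym_group m). 4)"
    by (rule order_trans[OF sum_abs sum_mono[OF abs_k_le]])
  also have "\<dots> = 4 * fact m" by (simp add: sym_group_card_carrier)
  finally show ?thesis by (simp add: src_kappa_def abs_mult field_simps)
qed

lemma transposition_14_23_mem:
  "j \<in> {1..m} \<Longrightarrow> transposition 1 4 j \<in> {1..m}" "j \<in> {1..m} \<Longrightarrow> transposition 2 3 j \<in> {1..m}"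
  using m by (auto simp: Transposition.transpose_def)

lemma depends_measurably_signed_sum:
  fixes I :: "(nat \<Rightarrow> real ^ 'd) \<Rightarrow> real"
  assumes "rank_indicator m I"
  shows "depends_measurably {1..m} (signed_sum (H_tau_star m) I)"
proof -
  have *: "depends_measurably {1..m} (\<lambda>w. I (w \<circ> \<tau>))" if "\<And>j. j \<in> {1..m} \<Longrightarrow> \<tau> j \<in> {1..m}" for \<tau>
    using depends_measurably_reindex[OF rank_indicator_depends_measurably[OF assms] that]
    by (simp add: comp_def)
  have comp: "(transposition 1 4 \<circ> transposition 2 3) j \<in> {1..m}" if "j \<in> {1..m}" for j
    by (simp only: comp_apply transposition_14_23_mem that)
  have eq: "signed_sum (H_tau_star m) I = (\<lambda>w. I (w \<circ> id) - I (w \<circ> transposition 1 4) -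
      I (w \<circ> transposition 2 3) + I (w \<circ> (transposition 1 4 \<circ> transposition 2 3)))"
    using signed_sum_H_tau_star[OF m, of I] by (auto simp: comp_assoc)
  show ?thesis
    unfolding eq by (intro depends_measurably_add depends_measurably_diff *[of id]
      *[OF transposition_14_23_mem(1)] *[OF transposition_14_23_mem(2)] *[OF comp]) simp_all
qed

lemmas depends_aX = depends_measurably_signed_sum[OF rank_IX]
  and depends_aY = depends_measurably_signed_sum[OF rank_IY]

lemma depends_k: "depends_measurably {1..m} k"
proof -
  have fs: "fst \<in> borel_measurable (borel :: ((real ^ 'r) \<times> (real ^ 's)) measure)"
    "snd \<in> borel_measurable (borel :: ((real ^ 'r) \<times> (real ^ 's)) measure)"
    by (simp_all flip: borel_prod)
  have "depends_measurably {1..m} (\<lambda>z :: nat \<Rightarrow> (real ^ 'r) \<times> (real ^ 's). aX (\<lambda>j. fst (z j)))"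
    using fs(1) by (intro depends_measurably_subst[OF depends_aX]) blast
  moreover have "depends_measurably {1..m} (\<lambda>z :: nat \<Rightarrow> (real ^ 'r) \<times> (real ^ 's). aY (\<lambda>j. snd (z j)))"
    using fs(2) by (intro depends_measurably_subst[OF depends_aY]) blast
  ultimately have "depends_measurably {1..m} (\<lambda>z. aX (\<lambda>j. fst (z j)) * aY (\<lambda>j. snd (z j)))"
    by (rule depends_measurably_mult)
  then show ?thesis by (simp add: src_k_def[abs_def])
qed

lemma inv_in: "\<sigma> permutes {1..m} \<Longrightarrow> j \<in> {1..m} \<Longrightarrow> inv' \<sigma> j \<in> {1..m}"
  by (meson permutes_in_image permutes_inv)

lemma depends_k_perm: "\<sigma> permutes {1..m} \<Longrightarrow> depends_measurably {1..m} (\<lambda>z. k (perm_act \<sigma> z))"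
  unfolding perm_act_def by (intro depends_measurably_reindex[OF depends_k] inv_in)

lemma depends_kappa: "depends_measurably {1..m} \<kappa>"
  unfolding depends_measurably_def
proof (intro conjI allI)
  show "\<kappa> \<in> borel_measurable (\<Pi>\<^sub>M j\<in>{1..m}. borel)"
    using depends_k_perm unfolding src_kappa_def[abs_def] depends_measurably_def sym_group_carrier
    by (intro borel_measurable_times borel_measurable_const borel_measurable_sum)
      (auto simp: sym_group_carrier)
  show "\<kappa> (restrict z {1..m}) = \<kappa> z" for z
    using depends_k_perm unfolding src_kappa_def depends_measurably_def
    by (auto simp: sym_group_carrier intro!: arg_cong2[where f = "(/)"] sum.cong)
qed

text \<open>Only the factor \<open>aX\<close> sees the swap. Agreement is asked on
  \<open>{1..m}\<close> alone because the index maps of the U-statistic are injective only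
  there.\<close>

lemma k_antisymmetric:
  assumes ab: "(a, b) \<in> {(1, 4), (2, 3)}"
    and v: "\<And>j. j \<in> {1..m} \<Longrightarrow> v j = (fst (w (transposition a b j)), snd (w j))"
  shows "k v = - k w"
proof -
  have "aX (\<lambda>j. fst (v j)) = aX ((\<lambda>j. fst (w j)) \<circ> transposition a b)"
    using v by (intro depends_measurably_cong[OF depends_aX]) auto
  moreover have "aY (\<lambda>j. snd (v j)) = aY (\<lambda>j. snd (w j))"
    using v by (intro depends_measurably_cong[OF depends_aY]) auto
  ultimately show ?thesis
    by (simp add: src_k_def signed_sum_swap[OF m ab])
qed

section \<open>The projections kappa_1 and kappa_2\<close>

definition perm_term :: "nat \<Rightarrow> (nat \<Rightarrow> (real ^ 'r) \<times> (real ^ 's)) \<Rightarrow> (nat \<Rightarrow> nat) \<Rightarrow> real" where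
  "perm_term i z \<sigma> = expectation (\<lambda>\<omega>. k (perm_act \<sigma> (splice_at i z (\<lambda>j. Z j \<omega>))))"

lemma depends_splice_at:
  assumes "depends_measurably {1..m} (F :: (nat \<Rightarrow> 'x::topological_space) \<Rightarrow> real)"
  shows "depends_measurably {1..m} (\<lambda>w. F (splice_at i z w))"
proof (rule depends_measurably_subst[OF assms])
  fix j assume j: "j \<in> {1..m}"
  show "\<exists>l\<in>{1..m}. \<exists>f\<in>borel_measurable borel. \<forall>x. splice_at i z x j = f (x l)"
  proof (cases "j \<le> i")
    case True then show ?thesis using j by (intro bexI[of _ j] bexI[of _ "\<lambda>_. z j"]) (auto simp: splice_at_def)
  next
    case False then show ?thesis using j by (intro bexI[of _ j] bexI[of _ id]) (auto simp: splice_at_def)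
  qed
qed

lemma random_variable_of_depends:
  "depends_measurably {1..n} F \<Longrightarrow> (\<lambda>\<omega>. F (\<lambda>j. Z j \<omega>)) \<in> borel_measurable M"
  by (rule depends_measurably_compose) (auto intro: measurable_Z)

lemma src_kappa_proj_eq:
  "src_kappa_proj M Z m (H_tau_star m) IX IY i z = 1 / fact m * (\<Sum>\<sigma> | \<sigma> permutes {1..m}. perm_term i z \<sigma>)"
proof -
  have "integrable M (\<lambda>\<omega>. k (perm_act \<sigma> (splice_at i z (\<lambda>j. Z j \<omega>))))" if "\<sigma> permutes {1..m}" for \<sigma>
    using random_variable_of_depends[OF depends_splice_at[OF depends_k_perm[OF that]]] abs_k_le
    by (intro integrable_const_bound[where B = 4]) auto
  then show ?thesis
    unfolding src_kappa_proj_def src_kappa_def perm_term_def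
    by (simp add: sym_group_def)
qed

text \<open>In \<open>perm_term i z \<sigma>\<close> kernel position \<open>j\<close> holds
  observation \<open>inv' \<sigma> j\<close>, which is random exactly when it exceeds
  \<open>i\<close>. By \<open>free\<close> the positions \<open>a\<close> and \<open>b\<close> both
  hold random observations, whose X-parts can be swapped.\<close>

lemma perm_term_eq_0:
  assumes \<sigma>: "\<sigma> permutes {1..m}" and ab: "(a, b) \<in> {(1, 4), (2, 3)}"
    and free: "i < inv' \<sigma> a" "i < inv' \<sigma> b"
  shows "perm_term i z \<sigma> = 0"
  unfolding perm_term_def
proof (rule expectation_eq_0_if_antisymmetric[of "{1..m}" _ "inv' \<sigma> a" "inv' \<sigma> b"])
  show "depends_measurably {1..m} (\<lambda>w. k (perm_act \<sigma> (splice_at i z w)))"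
    by (rule depends_splice_at[OF depends_k_perm[OF \<sigma>]])
  have abm: "a \<in> {1..m}" "b \<in> {1..m}" using ab m by auto
  then show "inv' \<sigma> a \<in> {1..m}" "inv' \<sigma> b \<in> {1..m}" using inv_in[OF \<sigma>] by auto
  fix w :: "nat \<Rightarrow> (real ^ 'r) \<times> (real ^ 's)"
  show "k (perm_act \<sigma> (splice_at i z (\<lambda>j. (fst (w (transposition (inv' \<sigma> a) (inv' \<sigma> b) j)), snd (w j))))) =
    - k (perm_act \<sigma> (splice_at i z w))"
  proof (rule k_antisymmetric[OF ab])
    fix j assume j: "j \<in> {1..m}"
    have "inv' \<sigma> (transposition a b j) = transposition (inv' \<sigma> a) (inv' \<sigma> b) (inv' \<sigma> j)"
      using permutes_inj[OF permutes_inv[OF \<sigma>]] by (rule inj_on_transpose_apply) auto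
    \<comment> \<open>Both swapped indices exceed \<open>i\<close>, so the swap leaves the fixed
      entries alone.\<close>
    then show "perm_act \<sigma> (splice_at i z (\<lambda>j. (fst (w (transposition (inv' \<sigma> a) (inv' \<sigma> b) j)), snd (w j)))) j =
      (fst (perm_act \<sigma> (splice_at i z w) (transposition a b j)), snd (perm_act \<sigma> (splice_at i z w) j))"
      using free by (auto simp: perm_act_def splice_at_def Transposition.transpose_def)
  qed
qed auto

lemma src_kappa_proj_1: "src_kappa_proj M Z m (H_tau_star m) IX IY 1 z = 0"
proof -
  have "perm_term 1 z \<sigma> = 0" if \<sigma>: "\<sigma> permutes {1..m}" for \<sigma>
  proof -
    have ge: "1 \<le> inv' \<sigma> j" if "j \<in> {1, 2, 3, 4}" for j using inv_in[OF \<sigma>, of j] m that by auto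
    have ne: "inv' \<sigma> j \<noteq> inv' \<sigma> l" if "j \<noteq> l" for j l
      using permutes_inj[OF permutes_inv[OF \<sigma>]] that by (auto dest: injD)
    \<comment> \<open>The value 1 is attained only once by \<open>inv' \<sigma>\<close>, so it
      cannot occur in both of the pairs {1, 4} and {2, 3}.\<close>
    have "1 < inv' \<sigma> 1 \<and> 1 < inv' \<sigma> 4 \<or> 1 < inv' \<sigma> 2 \<and> 1 < inv' \<sigma> 3"
      using ge[of 1] ge[of 2] ge[of 3] ge[of 4] ne[of 1 2] ne[of 1 3] ne[of 4 2] ne[of 4 3]
      unfolding le_less by auto
    then show ?thesis using perm_term_eq_0[OF \<sigma>, of 1 4] perm_term_eq_0[OF \<sigma>, of 2 3] by auto
  qed
  then show ?thesis by (simp add: src_kappa_proj_eq)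
qed

text \<open>Left multiplication by \<open>\<delta>\<close> permutes kernel positions, and
  \<open>k\<close> is invariant under it, so the integrands coincide pointwise.\<close>

lemma perm_term_comp:
  assumes \<sigma>: "\<sigma> permutes {1..m}" and \<delta>: "\<delta> \<in> {transposition 1 4, transposition 2 3, transposition 1 2 \<circ> transposition 3 4}"
  shows "perm_term i z (\<delta> \<circ> \<sigma>) = perm_term i z \<sigma>"
proof -
  have "bij \<delta>" using \<delta> by (auto intro: bij_comp)
  then show ?thesis
    unfolding perm_term_def using permutes_bij[OF \<sigma>] by (simp add: perm_act_comp src_k_perm_act[OF m invariant \<delta>])
qed

text \<open>A permutation fixing 1 and 2 merely rearranges the random observations; the same
  permutation in both coordinates preserves their law.\<close>

lemma perm_term_stabilizer:
  assumes \<sigma>: "\<sigma> permutes {1..m}" and fixed: "\<sigma> 1 = 1" "\<sigma> 2 = 2"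
  shows "perm_term 2 z \<sigma> = perm_term 2 z id"
proof -
  let ?F = "\<lambda>w. k (splice_at 2 z w)"
  have "inv' \<sigma> j \<le> 2 \<longleftrightarrow> j \<le> 2" "j \<le> 2 \<Longrightarrow> inv' \<sigma> j = j" for j
  proof -
    have fix': "\<sigma> i = i" if "i \<le> 2" for i
    proof -
      have "i = 0 \<or> i = 1 \<or> i = 2" using that by auto
      \<comment> \<open>\<open>splice_at 2\<close> fixes entry 0 as well; it lies outside
        \<open>{1..m}\<close>, so \<open>\<sigma>\<close> does not move it.\<close>
      moreover have "\<sigma> 0 = 0" using \<sigma> by (rule permutes_not_in) simp
      ultimately show ?thesis using fixed by auto
    qed
    show "j \<le> 2 \<Longrightarrow> inv' \<sigma> j = j" using fix'[of j] permutes_inv_eq[OF \<sigma>, of j j] by simp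
    then show "inv' \<sigma> j \<le> 2 \<longleftrightarrow> j \<le> 2" using fix'[of "inv' \<sigma> j"] permutes_inverses(1)[OF \<sigma>, of j] by auto
  qed
  then have "perm_act \<sigma> (splice_at 2 z w) = splice_at 2 z (\<lambda>j. w (inv' \<sigma> j))" for w
    by (auto simp: perm_act_def splice_at_def fun_eq_iff)
  then have "perm_term 2 z \<sigma> = expectation (\<lambda>\<omega>. ?F (\<lambda>j. (fst (Z (inv' \<sigma> j) \<omega>), snd (Z (inv' \<sigma> j) \<omega>))))"
    by (simp add: perm_term_def)
  also have "\<dots> = expectation (\<lambda>\<omega>. ?F (\<lambda>j. Z j \<omega>))"
    using m permutes_inv[OF \<sigma>]
    by (intro expectation_permute[of "{1..m}" ?F] depends_splice_at depends_k) auto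
  finally show ?thesis by (simp add: perm_term_def)
qed

text \<open>Observation 1 occupies position \<open>\<sigma> 1\<close> and observation 2 position
  \<open>\<sigma> 2\<close>. A straddling placement reaches the standard one in at most three steps:
  (1 2)(3 4) exchanges the pairs {1, 4} and {2, 3}, then (1 4) brings \<open>\<sigma> 1\<close> to 1
  and (2 3) brings \<open>\<sigma> 2\<close> to 2; what remains fixes 1 and 2.\<close>

lemma perm_term_2:
  assumes \<sigma>: "\<sigma> permutes {1..m}"
  shows "perm_term 2 z \<sigma> = (if \<sigma> 1 \<in> {1, 4} \<and> \<sigma> 2 \<in> {2, 3} \<or> \<sigma> 1 \<in> {2, 3} \<and> \<sigma> 2 \<in> {1, 4} then perm_term 2 z id else 0)"
proof -
  have perm: "\<delta> \<circ> \<tau> permutes {1..m}"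
    if "\<tau> permutes {1..m}" "\<delta> \<in> {transposition 1 4, transposition 2 3, transposition 1 2 \<circ> transposition 3 4}" for \<delta> \<tau>
    using that m by (auto intro!: permutes_compose permutes_swap_id)
  have good_1: "perm_term 2 z \<tau> = perm_term 2 z id" if \<tau>: "\<tau> permutes {1..m}" "\<tau> 1 = 1" "\<tau> 2 \<in> {2, 3}" for \<tau>
  proof (cases "\<tau> 2 = 2")
    case True
    then show ?thesis using \<tau> by (intro perm_term_stabilizer) auto
  next
    case False
    have "perm_term 2 z (transposition 2 3 \<circ> \<tau>) = perm_term 2 z id"
      using \<tau> False by (intro perm_term_stabilizer perm) auto
    then show ?thesis using perm_term_comp[OF \<tau>(1), of "transposition 2 3"] by simp
  qed
  have good: "perm_term 2 z \<tau> = perm_term 2 z id" if \<tau>: "\<tau> permutes {1..m}" "\<tau> 1 \<in> {1, 4}" "\<tau> 2 \<in> {2, 3}" for \<tau>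
  proof (cases "\<tau> 1 = 1")
    case True
    then show ?thesis using \<tau> by (intro good_1) auto
  next
    case False
    have "perm_term 2 z (transposition 1 4 \<circ> \<tau>) = perm_term 2 z id"
      using \<tau> False by (intro good_1 perm) auto
    then show ?thesis using perm_term_comp[OF \<tau>(1), of "transposition 1 4"] by simp
  qed
  consider "\<sigma> 1 \<in> {1, 4}" "\<sigma> 2 \<in> {2, 3}" | "\<sigma> 1 \<in> {2, 3}" "\<sigma> 2 \<in> {1, 4}"
    | "\<not> (\<sigma> 1 \<in> {1, 4} \<and> \<sigma> 2 \<in> {2, 3} \<or> \<sigma> 1 \<in> {2, 3} \<and> \<sigma> 2 \<in> {1, 4})" by blast
  then show ?thesis
  proof cases
    case 1
    then show ?thesis using good[OF \<sigma>] by simp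
  next
    case 2
    let ?\<delta> = "transposition 1 2 \<circ> transposition 3 (4::nat)"
    have "perm_term 2 z (?\<delta> \<circ> \<sigma>) = perm_term 2 z id"
    proof (rule good)
      show "?\<delta> \<circ> \<sigma> permutes {1..m}" by (rule perm[OF \<sigma>]) simp
      show "(?\<delta> \<circ> \<sigma>) 1 \<in> {1, 4}" "(?\<delta> \<circ> \<sigma>) 2 \<in> {2, 3}"
        using 2 by (auto simp: Transposition.transpose_def)
    qed
    then show ?thesis using 2 perm_term_comp[OF \<sigma>, of ?\<delta>] by simp
  next
    case 3
    have ge: "2 < inv' \<sigma> j" if "j \<in> {1, 2, 3, 4}" "j \<noteq> \<sigma> 1" "j \<noteq> \<sigma> 2" for j
    proof -
      have "inv' \<sigma> j \<noteq> 1" "inv' \<sigma> j \<noteq> 2" using that permutes_inverses(1)[OF \<sigma>, of j] by auto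
      moreover have "1 \<le> inv' \<sigma> j" using inv_in[OF \<sigma>, of j] m that by auto
      ultimately show ?thesis by linarith
    qed
    \<comment> \<open>The two pairs are disjoint, so without straddling one of them contains neither
      \<open>\<sigma> 1\<close> nor \<open>\<sigma> 2\<close>, and both its positions hold random
      observations.\<close>
    have "(\<sigma> 1 \<notin> {1, 4} \<and> \<sigma> 2 \<notin> {1, 4}) \<or> (\<sigma> 1 \<notin> {2, 3} \<and> \<sigma> 2 \<notin> {2, 3})"
      using 3 by auto
    then have "perm_term 2 z \<sigma> = 0"
      using perm_term_eq_0[OF \<sigma>, of 1 4 2] perm_term_eq_0[OF \<sigma>, of 2 3 2] ge[of 1] ge[of 2] ge[of 3] ge[of 4] by auto
    then show ?thesis using 3 by auto
  qed
qed

text \<open>For fixed \<open>z\<close> the integrand separates into a function of the X-sample and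
  one of the Y-sample, both bounded by 2.\<close>

lemma perm_term_2_id:
  "perm_term 2 z id = (\<integral>\<omega>. aX (splice_at 2 (\<lambda>j. fst (z j)) (\<lambda>j. fst (Z j \<omega>))) \<partial>M) *
    (\<integral>\<omega>. aY (splice_at 2 (\<lambda>j. snd (z j)) (\<lambda>j. snd (Z j \<omega>))) \<partial>M)"
proof -
  have splice: "(\<lambda>j. fst (splice_at 2 z w j)) = splice_at 2 (\<lambda>j. fst (z j)) (\<lambda>j. fst (w j))"
    "(\<lambda>j. snd (splice_at 2 z w j)) = splice_at 2 (\<lambda>j. snd (z j)) (\<lambda>j. snd (w j))" for w
    by (auto simp: splice_at_def)
  show ?thesis
    unfolding perm_term_def perm_act_id src_k_def splice
    using m abs_a_le by (intro expectation_mult[of "{1..m}" "\<lambda>x. aX (splice_at 2 (\<lambda>j. fst (z j)) x)" 2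
      "\<lambda>y. aY (splice_at 2 (\<lambda>j. snd (z j)) y)"] depends_splice_at depends_aX depends_aY) auto
qed

text \<open>All straddling permutations contribute \<open>perm_term 2 z id\<close>, and
  \<open>8 * fact (m - 2) / fact m = 4 / (m choose 2)\<close>.\<close>

lemma src_kappa_proj_2:
  "src_kappa_proj M Z m (H_tau_star m) IX IY 2 z = 4 / real (m choose 2) *
    (\<integral>\<omega>. aX (splice_at 2 (\<lambda>j. fst (z j)) (\<lambda>j. fst (Z j \<omega>))) \<partial>M) *
    (\<integral>\<omega>. aY (splice_at 2 (\<lambda>j. snd (z j)) (\<lambda>j. snd (Z j \<omega>))) \<partial>M)"
proof -
  have "(\<Sum>\<sigma> | \<sigma> permutes {1..m}. perm_term 2 z \<sigma>) = 8 * fact (m - 2) * perm_term 2 z id"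
    unfolding sum_straddling_permutations[OF m, symmetric] using perm_term_2 by (intro sum.cong) auto
  moreover have "real (m choose 2) = fact m / (2 * fact (m - 2))"
    using m by (simp add: binomial_fact)
  ultimately show ?thesis
    unfolding src_kappa_proj_eq by (simp add: perm_term_2_id)
qed

section \<open>Second moment of the U-statistic and degeneracy\<close>

lemma expectation_kappa_mult_eq_0:
  assumes i: "i \<in> {1..m} \<rightarrow>\<^sub>E {1..n}" "inj_on i {1..m}" and i': "i' \<in> {1..m} \<rightarrow>\<^sub>E {1..n}"
    and few: "\<not> (\<exists>p\<in>{1..m}. \<exists>p'\<in>{1..m}. \<exists>q\<in>{1..m}. \<exists>q'\<in>{1..m}. q \<noteq> q' \<and> i p = i' q \<and> i p' = i' q')"
  shows "expectation (\<lambda>\<omega>. \<kappa> (\<lambda>j. Z (i j) \<omega>) * \<kappa> (\<lambda>j. Z (i' j) \<omega>)) = 0"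
proof -
  have dep: "depends_measurably {1..n} (\<lambda>w. F (\<lambda>j. w (f j)))"
    if "depends_measurably {1..m} F" "f \<in> {1..m} \<rightarrow>\<^sub>E {1..n}" for F f
    using that(2) by (intro depends_measurably_reindex[OF that(1)]) (rule PiE_mem)
  \<comment> \<open>Only the first factor is expanded over permutations. Two of its observations
    that are absent from the second factor can have their X-parts swapped without affecting the
    latter; \<open>few\<close> provides such a pair for every \<open>\<sigma>\<close>.\<close>
  let ?F = "\<lambda>\<sigma> w. k (perm_act \<sigma> (\<lambda>j. w (i j))) * \<kappa> (\<lambda>j. w (i' j))"
  have depF: "depends_measurably {1..n} (?F \<sigma>)" if "\<sigma> permutes {1..m}" for \<sigma>
    by (intro depends_measurably_mult dep[OF depends_k_perm[OF that]] dep[OF depends_kappa] i(1) i')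
  have 0: "expectation (\<lambda>\<omega>. ?F \<sigma> (\<lambda>j. Z j \<omega>)) = 0" if \<sigma>: "\<sigma> permutes {1..m}" for \<sigma>
  proof -
    have abm: "a \<in> {1..m}" "b \<in> {1..m}" if "(a, b) \<in> {(1, 4), (2, 3)}" for a b using that m by auto
    have "\<exists>(a, b)\<in>{(1, 4), (2, 3)}. \<forall>q\<in>{1..m}. i (inv' \<sigma> a) \<noteq> i' q \<and> i (inv' \<sigma> b) \<noteq> i' q"
    proof (rule ccontr)
      \<comment> \<open>Otherwise each of {1, 4} and {2, 3} contains a position whose observation is
        also indexed by \<open>i'\<close>. The two observations differ because \<open>i\<close> is
        injective, which yields \<open>q \<noteq> q'\<close> and contradicts
        \<open>few\<close>.\<close>
      assume "\<not> ?thesis"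
      then obtain a b q q' where ab: "a \<in> {1, 4}" "b \<in> {2, 3}" "q \<in> {1..m}" "q' \<in> {1..m}"
        "i (inv' \<sigma> a) = i' q" "i (inv' \<sigma> b) = i' q'"
        by auto metis+
      have "a \<in> {1..m}" "b \<in> {1..m}" using ab m by auto
      then have mem: "inv' \<sigma> a \<in> {1..m}" "inv' \<sigma> b \<in> {1..m}" by (simp_all only: inv_in[OF \<sigma>])
      have "a \<noteq> b" using ab(1,2) by auto
      then have "inv' \<sigma> a \<noteq> inv' \<sigma> b"
        by (simp only: inj_eq[OF permutes_inj[OF permutes_inv[OF \<sigma>]]] not_False_eq_True)
      then have "i' q \<noteq> i' q'"
        unfolding ab(5,6)[symmetric] using i(2) mem by (simp only: inj_on_eq_iff not_False_eq_True)
      then have "q \<noteq> q'" by blast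
      then show False using few ab(3-6) mem by blast
    qed
    then obtain a b where ab: "(a, b) \<in> {(1, 4), (2, 3)}"
      and free: "\<And>q. q \<in> {1..m} \<Longrightarrow> i (inv' \<sigma> a) \<noteq> i' q \<and> i (inv' \<sigma> b) \<noteq> i' q" by blast
    let ?c = "i (inv' \<sigma> a)" and ?d = "i (inv' \<sigma> b)"
    show ?thesis
    proof (rule expectation_eq_0_if_antisymmetric[of "{1..n}" "?F \<sigma>" ?c ?d])
      show "depends_measurably {1..n} (?F \<sigma>)" by (rule depF[OF \<sigma>])
      show "?c \<in> {1..n}" "?d \<in> {1..n}"
        using abm[OF ab] inv_in[OF \<sigma>] PiE_mem[OF i(1)] by auto
      fix w :: "nat \<Rightarrow> (real ^ 'r) \<times> (real ^ 's)"
      let ?w = "\<lambda>j. (fst (w (transposition ?c ?d j)), snd (w j))"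
      have "inj_on (\<lambda>j. i (inv' \<sigma> j)) {1..m}"
      proof (rule inj_onI)
        fix x y assume xy: "x \<in> {1..m}" "y \<in> {1..m}" "i (inv' \<sigma> x) = i (inv' \<sigma> y)"
        then have "inv' \<sigma> x = inv' \<sigma> y"
          using inj_onD[OF i(2) xy(3) inv_in[OF \<sigma> xy(1)] inv_in[OF \<sigma> xy(2)]] by simp
        then show "x = y" by (simp only: inj_eq[OF permutes_inj[OF permutes_inv[OF \<sigma>]]])
      qed
      from inj_on_transpose_apply[OF this abm[OF ab]]
      have "k (perm_act \<sigma> (\<lambda>j. ?w (i j))) = - k (perm_act \<sigma> (\<lambda>j. w (i j)))"
        by (intro k_antisymmetric[OF ab]) (simp add: perm_act_def)
      moreover have "\<kappa> (\<lambda>j. ?w (i' j)) = \<kappa> (\<lambda>j. w (i' j))"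
      proof (rule depends_measurably_cong[OF depends_kappa])
        fix j assume "j \<in> {1..m}"
        from free[OF this] have "transposition ?c ?d (i' j) = i' j" by (intro transpose_apply_other) auto
        then show "?w (i' j) = w (i' j)" by simp
      qed
      ultimately show "?F \<sigma> ?w = - ?F \<sigma> w" by simp
    qed auto
  qed
  have int: "integrable M (\<lambda>\<omega>. ?F \<sigma> (\<lambda>j. Z j \<omega>))" if "\<sigma> permutes {1..m}" for \<sigma>
  proof (rule integrable_const_bound[where B = "4 * 4"])
    have "\<bar>?F \<sigma> w\<bar> \<le> 4 * 4" for w
      unfolding abs_mult by (intro mult_mono abs_k_le abs_kappa_le) auto
    then show "AE \<omega> in M. norm (?F \<sigma> (\<lambda>j. Z j \<omega>)) \<le> 4 * 4" by (intro AE_I2) simp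
  qed (rule random_variable_of_depends[OF depF[OF that]])
  have "expectation (\<lambda>\<omega>. \<kappa> (\<lambda>j. Z (i j) \<omega>) * \<kappa> (\<lambda>j. Z (i' j) \<omega>)) =
      expectation (\<lambda>\<omega>. 1 / fact m * (\<Sum>\<sigma> | \<sigma> permutes {1..m}. ?F \<sigma> (\<lambda>j. Z j \<omega>)))"
    unfolding src_kappa_def[of m _ _ _ "\<lambda>j. Z (i j) _"] by (simp add: sum_distrib_right sym_group_def)
  also have "\<dots> = 1 / fact m * (\<Sum>\<sigma> | \<sigma> permutes {1..m}. expectation (\<lambda>\<omega>. ?F \<sigma> (\<lambda>j. Z j \<omega>)))"
    using int by simp
  also have "\<dots> = 0" using 0 by simp
  finally show ?thesis .
qed

text \<open>The square of the sum expands over pairs of index tuples, each contributing at most 16,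
  and only pairs sharing two indices survive. There are at most m^4 n^(2m-2) of these, while
  \<open>n choose m\<close> is at least (n/m)^m.\<close>

lemma second_moment_U_le:
  assumes n: "m \<le> n" and n0: "0 < n"
  defines "U \<equiv> \<lambda>\<omega>. src_U m (H_tau_star m) IX IY n (\<lambda>j. Z j \<omega>)"
  shows "U \<in> borel_measurable M" "integrable M (\<lambda>\<omega>. (U \<omega>)\<^sup>2)"
    "expectation (\<lambda>\<omega>. (U \<omega>)\<^sup>2) \<le> 16 * real m ^ (2 * m + 4) / (real n)\<^sup>2"
proof -
  let ?P = "{1..m} \<rightarrow>\<^sub>E {1..n}"
  define D where "D = {i \<in> ?P. strict_mono_on {1..m} i}"
  define W where "W i \<omega> = \<kappa> (\<lambda>j. Z (i j) \<omega>)" for i \<omega>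
  define c where "c = 1 / real (n choose m)"
  \<comment> \<open>\<open>bad\<close> admits all index functions, not only increasing ones; this
    overcounts, but the cardinality bound applies to it directly.\<close>
  define bad where "bad = {(i, i'). i \<in> ?P \<and> i' \<in> ?P \<and>
    (\<exists>p\<in>{1..m}. \<exists>p'\<in>{1..m}. \<exists>q\<in>{1..m}. \<exists>q'\<in>{1..m}. q \<noteq> q' \<and> i p = i' q \<and> i p' = i' q')}"
  have finP: "finite ?P" by (simp add: finite_PiE)
  then have finD: "finite D" unfolding D_def by simp
  have bad: "finite bad"
    by (rule finite_subset[OF _ finite_cartesian_product[OF finP finP]]) (auto simp only: bad_def)
  have W: "W i \<in> borel_measurable M" if "i \<in> D" for i
    unfolding W_def[abs_def]
  proof (rule depends_measurably_compose[OF depends_kappa])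
    fix j assume "j \<in> {1..m}"
    then have "i j \<in> {1..n}" using that unfolding D_def by (blast dest: PiE_mem)
    then show "Z (i j) \<in> borel_measurable M" by (intro measurable_Z) simp
  qed
  have WW_le: "\<bar>W i \<omega> * W i' \<omega>\<bar> \<le> 16" for i i' \<omega>
    using mult_mono[OF abs_kappa_le[of "\<lambda>j. Z (i j) \<omega>"] abs_kappa_le[of "\<lambda>j. Z (i' j) \<omega>"]]
    by (simp add: W_def abs_mult)
  have WW: "integrable M (\<lambda>\<omega>. W i \<omega> * W i' \<omega>)" if "i \<in> D" "i' \<in> D" for i i'
    using WW_le by (intro integrable_const_bound[where B = 16] AE_I2 borel_measurable_times W that) simp
  have U: "U = (\<lambda>\<omega>. c * (\<Sum>i\<in>D. W i \<omega>))"
    by (simp add: U_def src_U_def c_def D_def W_def)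
  show "U \<in> borel_measurable M"
    unfolding U by (intro borel_measurable_times borel_measurable_const borel_measurable_sum W)
  have sq: "(U \<omega>)\<^sup>2 = c\<^sup>2 * (\<Sum>(i, i')\<in>D \<times> D. W i \<omega> * W i' \<omega>)" for \<omega>
    by (simp add: U power_mult_distrib power2_eq_square[of "\<Sum>i\<in>D. W i \<omega>"] sum_product sum.cartesian_product)
  have int: "integrable M (\<lambda>\<omega>. case t of (i, i') \<Rightarrow> W i \<omega> * W i' \<omega>)" if "t \<in> D \<times> D" for t
    using that WW by auto
  show "integrable M (\<lambda>\<omega>. (U \<omega>)\<^sup>2)"
    unfolding sq using int by (intro integrable_mult_right Bochner_Integration.integrable_sum)
  have "expectation (\<lambda>\<omega>. (U \<omega>)\<^sup>2) =
      c\<^sup>2 * (\<Sum>t\<in>D \<times> D. expectation (\<lambda>\<omega>. case t of (i, i') \<Rightarrow> W i \<omega> * W i' \<omega>))"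
    unfolding sq using int by (simp add: Bochner_Integration.integral_sum)
  also have "(\<Sum>t\<in>D \<times> D. expectation (\<lambda>\<omega>. case t of (i, i') \<Rightarrow> W i \<omega> * W i' \<omega>)) =
      (\<Sum>t\<in>(D \<times> D) \<inter> bad. expectation (\<lambda>\<omega>. case t of (i, i') \<Rightarrow> W i \<omega> * W i' \<omega>))"
  proof (rule sum.mono_neutral_right)
    show "\<forall>t\<in>D \<times> D - D \<times> D \<inter> bad. expectation (\<lambda>\<omega>. case t of (i, i') \<Rightarrow> W i \<omega> * W i' \<omega>) = 0"
    proof
      fix t assume t: "t \<in> D \<times> D - D \<times> D \<inter> bad"
      obtain i i' where ii: "t = (i, i')" by (cases t)
      have D: "i \<in> ?P" "i' \<in> ?P" "inj_on i {1..m}" and few: "(i, i') \<notin> bad"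
        using t strict_mono_on_imp_inj_on unfolding ii D_def by blast+
      show "expectation (\<lambda>\<omega>. case t of (i, i') \<Rightarrow> W i \<omega> * W i' \<omega>) = 0"
        unfolding ii case_prod_conv W_def
        using few D(1,2) unfolding bad_def mem_Collect_eq case_prod_conv
        by (intro expectation_kappa_mult_eq_0[OF D(1,3,2)]) blast
    qed
  qed (use finD in auto)
  also have "\<dots> \<le> (\<Sum>t\<in>(D \<times> D) \<inter> bad. 16)"
  proof (rule sum_mono)
    fix t assume "t \<in> (D \<times> D) \<inter> bad"
    then show "expectation (\<lambda>\<omega>. case t of (i, i') \<Rightarrow> W i \<omega> * W i' \<omega>) \<le> 16"
      using abs_le_D1[OF WW_le] by (intro integral_le_const int AE_I2) (auto split: prod.split)
  qed
  also have "\<dots> \<le> 16 * real (card bad)"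
    using card_mono[OF bad, of "(D \<times> D) \<inter> bad"] by simp
  also have "real (card bad) \<le> real (m ^ 4 * (n ^ m * n ^ (m - 2)))"
    using card_sharing_two_values_le[of "{1..m}" n] unfolding bad_def by (simp del: of_nat_mult of_nat_power)
  finally have "expectation (\<lambda>\<omega>. (U \<omega>)\<^sup>2) \<le> c\<^sup>2 * (16 * real (m ^ 4 * (n ^ m * n ^ (m - 2))))"
    by (simp add: mult_left_mono)
  also have "\<dots> \<le> ((real m / real n) ^ m)\<^sup>2 * (16 * real (m ^ 4 * (n ^ m * n ^ (m - 2))))"
  proof (intro mult_right_mono power_mono)
    have "(real n / real m) ^ m \<le> real (n choose m)"
      by (rule binomial_ge_n_over_k_pow_k[OF n])
    then have "1 / real (n choose m) \<le> 1 / (real n / real m) ^ m"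
      using n0 m by (intro divide_left_mono) (auto simp: n)
    then show "c \<le> (real m / real n) ^ m"
      by (simp add: c_def power_divide)
  qed (auto simp: c_def)
  also have "\<dots> = 16 * real m ^ (2 * m + 4) / (real n)\<^sup>2"
  proof -
    \<comment> \<open>The subtraction is truncated, so \<open>4 \<le> m\<close> is used to split
      \<open>n ^ m\<close> into \<open>n ^ (m - 2)\<close> and a square, which survives as the
      denominator.\<close>
    have "m - 2 + 2 = m" using m by simp
    then have n_m: "real n ^ m = real n ^ (m - 2) * (real n)\<^sup>2"
      using power_add[of "real n" "m - 2" 2] by (simp only:)
    have m_m: "real m ^ (2 * m + 4) = (real m ^ m)\<^sup>2 * real m ^ 4"
      by (simp only: power_add power_mult[symmetric] mult.commute[of m 2])
    have cancel: "a\<^sup>2 / (x * y)\<^sup>2 * (16 * (b * ((x * y) * x))) = 16 * (a\<^sup>2 * b) / y"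
      if "x \<noteq> 0" "y \<noteq> 0" for a b x y :: real
      using that by (simp add: field_simps power2_eq_square)
    show ?thesis
      unfolding of_nat_mult of_nat_power power_divide m_m n_m using n0 by (intro cancel) auto
  qed
  finally show "expectation (\<lambda>\<omega>. (U \<omega>)\<^sup>2) \<le> 16 * real m ^ (2 * m + 4) / (real n)\<^sup>2" .
qed

text \<open>Chebyshev's inequality at level \<epsilon>/sqrt n: the O(n^(-2)) second moment is
  divided by \<epsilon>^2/n, which leaves O(1/n).\<close>

lemma degenerate_U:
  "converges_in_prob M
    (\<lambda>n \<omega>. sqrt (real n) * (src_U m (H_tau_star m) IX IY n (\<lambda>j. Z j \<omega>) -
      (\<integral>\<omega>'. src_U m (H_tau_star m) IX IY n (\<lambda>j. Z j \<omega>') \<partial>M))) (\<lambda>_. 0)"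
  unfolding converges_in_prob_def
proof (intro allI impI)
  fix \<epsilon> :: real assume \<epsilon>: "\<epsilon> > 0"
  define U where "U n \<omega> = src_U m (H_tau_star m) IX IY n (\<lambda>j. Z j \<omega>)" for n \<omega>
  define C where "C = 16 * real m ^ (2 * m + 4) / \<epsilon>\<^sup>2"
  define P where "P n = prob {\<omega> \<in> space M. \<bar>sqrt (real n) * (U n \<omega> - expectation (U n)) - 0\<bar> > \<epsilon>}" for n
  have "P n \<le> C * (1 / real n)" if n: "m \<le> n" "0 < n" for n
  proof -
    note U = second_moment_U_le[OF n, folded U_def[abs_def] U_def]
    let ?a = "\<epsilon> / sqrt (real n)"
    have U1: "integrable M (U n)"
      using square_integrable_imp_integrable[OF U(1,2)] by simp
    have "P n \<le> prob {\<omega> \<in> space M. ?a \<le> \<bar>U n \<omega> - expectation (U n)\<bar>}"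
      unfolding P_def using U(1) n
      by (intro finite_measure_mono) (auto simp: abs_mult pos_divide_le_eq mult.commute)
    also have "\<dots> \<le> variance (U n) / ?a\<^sup>2"
      using \<epsilon> n by (intro Chebyshev_inequality U) auto
    \<comment> \<open>Dropping the squared mean bounds the variance by the second moment.\<close>
    also have "\<dots> \<le> expectation (\<lambda>\<omega>. (U n \<omega>)\<^sup>2) / ?a\<^sup>2"
      by (intro divide_right_mono) (simp_all add: variance_eq[OF U1 U(2)])
    also have "\<dots> \<le> 16 * real m ^ (2 * m + 4) / (real n)\<^sup>2 / ?a\<^sup>2"
      by (intro divide_right_mono U) simp
    also have "\<dots> = C * (1 / real n)"
      using n \<epsilon> by (simp add: C_def power_divide field_simps power2_eq_square)
    finally show ?thesis .
  qed
  then have "\<forall>\<^sub>F n in sequentially. P n \<le> C * (1 / real n)"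
    using m by (intro eventually_sequentiallyI[of m]) auto
  moreover have "(\<lambda>n. C * (1 / real n)) \<longlonglongrightarrow> C * 0"
    by (intro tendsto_mult tendsto_const lim_1_over_n)
  ultimately have "P \<longlonglongrightarrow> 0"
    by (intro tendsto_sandwich[of "\<lambda>_. 0" P sequentially "\<lambda>n. C * (1 / real n)"]) (auto simp: P_def)
  then show "(\<lambda>n. prob {\<omega> \<in> space M. \<bar>sqrt (real n) * (src_U m (H_tau_star m) IX IY n (\<lambda>j. Z j \<omega>) -
      (\<integral>\<omega>'. src_U m (H_tau_star m) IX IY n (\<lambda>j. Z j \<omega>') \<partial>M)) - 0\<bar> > \<epsilon>}) \<longlonglongrightarrow> 0"
    by (simp only: P_def[abs_def] U_def[abs_def])
qed

end

section \<open>Kernel results together with the concrete representations\<close>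

theorem lemma5p8:
  fixes M :: "'a measure"
    and X :: "'a \<Rightarrow> real ^ 'r" and Y :: "'a \<Rightarrow> real ^ 's"
    and Z :: "nat \<Rightarrow> 'a \<Rightarrow> (real ^ 'r) \<times> (real ^ 's)"
    and m :: nat
    and IX :: "(nat \<Rightarrow> real ^ 'r) \<Rightarrow> real" and IY :: "(nat \<Rightarrow> real ^ 's) \<Rightarrow> real"
  shows
    "(prob_space M \<longrightarrow>
      independent_rvs M X Y \<longrightarrow>
      prob_space.indep_vars M (\<lambda>_. borel) Z {1..} \<longrightarrow>
      (\<forall>i\<ge>1. distr M borel (Z i) = distr M borel (\<lambda>\<omega>. (X \<omega>, Y \<omega>))) \<longrightarrow>
      4 \<le> m \<longrightarrow> rank_indicator m IX \<longrightarrow> rank_indicator m IY \<longrightarrow>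
      G_tau_star m \<subseteq> src_invariance_group m IX IY \<longrightarrow>
        (\<forall>z. src_kappa_proj M Z m (H_tau_star m) IX IY 1 z = 0) \<and>
        converges_in_prob M
          (\<lambda>n \<omega>. sqrt (real n) *
             (src_U m (H_tau_star m) IX IY n (\<lambda>j. Z j \<omega>) -
              (\<integral>\<omega>'. src_U m (H_tau_star m) IX IY n (\<lambda>j. Z j \<omega>') \<partial>M)))
          (\<lambda>_. 0) \<and>
        (\<forall>z. src_kappa_proj M Z m (H_tau_star m) IX IY 2 z =
           4 / real (m choose 2) *
           (\<integral>\<omega>. signed_sum (H_tau_star m) IX
                   (splice_at 2 (\<lambda>j. fst (z j)) (\<lambda>j. fst (Z j \<omega>))) \<partial>M) *
           (\<integral>\<omega>. signed_sum (H_tau_star m) IY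
                   (splice_at 2 (\<lambda>j. snd (z j)) (\<lambda>j. snd (Z j \<omega>))) \<partial>M))) \<and>
     (rank_indicator 4 I_tau_star \<and>
      G_tau_star 4 \<subseteq> src_invariance_group 4 I_tau_star I_tau_star) \<and>
     (rank_indicator 5 (I_D :: (nat \<Rightarrow> real ^ 'r) \<Rightarrow> real) \<and>
      rank_indicator 5 (I_D :: (nat \<Rightarrow> real ^ 's) \<Rightarrow> real) \<and>
      G_tau_star 5 \<subseteq> src_invariance_group 5
        (I_D :: (nat \<Rightarrow> real ^ 'r) \<Rightarrow> real) (I_D :: (nat \<Rightarrow> real ^ 's) \<Rightarrow> real)) \<and>
     (\<forall>(numX :: 'r \<Rightarrow> nat) (numY :: 's \<Rightarrow> nat).
        bij_betw numX UNIV {1..CARD('r)} \<longrightarrow> bij_betw numY UNIV {1..CARD('s)} \<longrightarrow>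
        (let mR = 4 + CARD('r) + CARD('s);
             RX = I_R (\<lambda>i. 4 + numX i);
             RY = I_R (\<lambda>i. 4 + CARD('r) + numY i)
         in rank_indicator mR RX \<and> rank_indicator mR RY \<and>
            G_tau_star mR \<subseteq> src_invariance_group mR RX RY)) \<and>
     (\<forall>(JX :: (nat \<Rightarrow> real ^ 'r) \<Rightarrow> real) (JY :: (nat \<Rightarrow> real ^ 's) \<Rightarrow> real).
        tau_star_extension JX JY \<longrightarrow> G_tau_star 4 \<subseteq> src_invariance_group 4 JX JY)"
proof (intro conjI impI allI)
  assume "prob_space M" "independent_rvs M X Y" "prob_space.indep_vars M (\<lambda>_. borel) Z {1..}"
    "\<forall>i\<ge>1. distr M borel (Z i) = distr M borel (\<lambda>\<omega>. (X \<omega>, Y \<omega>))"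
    "4 \<le> m" "rank_indicator m IX" "rank_indicator m IY" "G_tau_star m \<subseteq> src_invariance_group m IX IY"
  then interpret tau_star_kernel M X Y Z m IX IY
    by (intro tau_star_kernel.intro iid_pairs.intro iid_pairs_axioms.intro tau_star_kernel_axioms.intro) auto
  show "src_kappa_proj M Z m (H_tau_star m) IX IY 1 z = 0" for z
    by (rule src_kappa_proj_1)
  show "converges_in_prob M
      (\<lambda>n \<omega>. sqrt (real n) * (src_U m (H_tau_star m) IX IY n (\<lambda>j. Z j \<omega>) -
        (\<integral>\<omega>'. src_U m (H_tau_star m) IX IY n (\<lambda>j. Z j \<omega>') \<partial>M))) (\<lambda>_. 0)"
    by (rule degenerate_U)
  show "src_kappa_proj M Z m (H_tau_star m) IX IY 2 z = 4 / real (m choose 2) *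
      (\<integral>\<omega>. signed_sum (H_tau_star m) IX (splice_at 2 (\<lambda>j. fst (z j)) (\<lambda>j. fst (Z j \<omega>))) \<partial>M) *
      (\<integral>\<omega>. signed_sum (H_tau_star m) IY (splice_at 2 (\<lambda>j. snd (z j)) (\<lambda>j. snd (Z j \<omega>))) \<partial>M)" for z
    by (rule src_kappa_proj_2)
next
  show "rank_indicator 4 I_tau_star" by (rule rank_indicator_I_tau_star)
  show "G_tau_star 4 \<subseteq> src_invariance_group 4 I_tau_star I_tau_star"
    by (simp add: G_tau_star_subset_src_invariance_group_iff G_tau_star_I_tau_star)
next
  \<comment> \<open>The fifth column lies within the order 5 and beyond the columns that the
    generators move.\<close>
  show "rank_indicator 5 (I_D :: (nat \<Rightarrow> real ^ 'r) \<Rightarrow> real)"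
    "rank_indicator 5 (I_D :: (nat \<Rightarrow> real ^ 's) \<Rightarrow> real)"
    "G_tau_star 5 \<subseteq> src_invariance_group 5
      (I_D :: (nat \<Rightarrow> real ^ 'r) \<Rightarrow> real) (I_D :: (nat \<Rightarrow> real ^ 's) \<Rightarrow> real)"
    by (simp_all add: I_D_eq_I_R rank_indicator_I_R G_tau_star_I_R G_tau_star_subset_src_invariance_group_iff)
next
  fix numX :: "'r \<Rightarrow> nat" and numY :: "'s \<Rightarrow> nat"
  assume "bij_betw numX UNIV {1..CARD('r)}" "bij_betw numY UNIV {1..CARD('s)}"
  then have "numX i \<in> {1..CARD('r)}" "numY j \<in> {1..CARD('s)}" for i j
    by (auto dest: bij_betwE)
  \<comment> \<open>The selected columns exceed 4, out of reach of the generators, and stay within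
    the order \<open>4 + CARD('r) + CARD('s)\<close>, as rank invariance requires.\<close>
  then have "4 < 4 + numX i" "4 + numX i \<in> {1..4 + CARD('r) + CARD('s)}"
    "4 < 4 + CARD('r) + numY j" "4 + CARD('r) + numY j \<in> {1..4 + CARD('r) + CARD('s)}" for i j
    by (simp_all add: less_eq_Suc_le trans_le_add1)
  then show "let mR = 4 + CARD('r) + CARD('s);
      RX = I_R (\<lambda>i. 4 + numX i);
      RY = I_R (\<lambda>i. 4 + CARD('r) + numY i)
    in rank_indicator mR RX \<and> rank_indicator mR RY \<and> G_tau_star mR \<subseteq> src_invariance_group mR RX RY"
    unfolding Let_def G_tau_star_subset_src_invariance_group_iff
    by (intro conjI rank_indicator_I_R G_tau_star_I_R) simp_all
next
  fix JX :: "(nat \<Rightarrow> real ^ 'r) \<Rightarrow> real" and JY :: "(nat \<Rightarrow> real ^ 's) \<Rightarrow> real"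
  assume "tau_star_extension JX JY"
  then show "G_tau_star 4 \<subseteq> src_invariance_group 4 JX JY"
    by (simp add: tau_star_extension_def src_invariance_group_def)
qed

end
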